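(* Consider the following four proper maps from $\mathbb{B}^2$ to $\mathbb{B}^3$: (a) $(z_1,z_2)\mapsto(z_1,z_2,0)$; (b) $(z_1,z_2)\mapsto(z_1,z_1z_2,z_2^2)$; (c) $(z_1,z_2)\mapsto(z_1^2,\sqrt{2}\,z_1z_2,z_2^2)$; (d) $(z_1,z_2)\mapsto(z_1^3,\sqrt{3}\,z_1z_2,z_2^3)$. Then: - For the map in (a), $G_f$ is trivial and $\Gamma_f=\mathrm{Aut}(\mathbb{B}^2)$. - For the map in (b), $G_f$ is trivial and $\Gamma_f=\mathbf{U}(1)\oplus\mathbf{U}(1)$. - For the map in (c), $G_f$ is cyclic of order two and $\Gamma_f=\mathbf{U}(2)$. - For the map in (d), $G_f$ is cyclic of order three, generated by $\begin{pmatrix}\eta&0\\0&\eta^2\end{pmatrix}$, where $\eta$ is a primitive cube root of unity. - For the map in (d), $\Gamma_f$ is the subgroup of $\mathbf{U}(2)$ generated by the matrices $\begin{pmatrix}e^{i\theta}&0\\0&e^{i\phi}\end{pmatrix}$ ($\theta,\phi\in\mathbb{R}$) and $\begin{pmatrix}0&1\\1&0\end{pmatrix}$.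
   Context: $\mathbb{B}^n$ is the open unit ball of $\mathbb{C}^n$, $\mathrm{Aut}(\mathbb{B}^n)$ is its group of holomorphic automorphisms, $\mathbf{U}(n)\leqslant\mathrm{Aut}(\mathbb{B}^n)$ is the unitary group, and $\mathbf{U}(1)\oplus\mathbf{U}(1)$ is the group of diagonal unitary $2\times2$ matrices. For a proper map $f:\mathbb{B}^n\to\mathbb{B}^N$, the invariant group is $G_f=\{\gamma\in\mathrm{Aut}(\mathbb{B}^n): f\circ\gamma=f\}$, and the Hermitian invariant group is $$\Gamma_f=\{\gamma\in\mathrm{Aut}(\mathbb{B}^n):\ \text{there is } \psi\in\mathrm{Aut}(\mathbb{B}^N)\text{ with } f\circ\gamma=\psi\circ f\}.$$ *)

theory Defs
  imports "HOL-Analysis.Analysis" "HOL-Algebra.Elementary_Groups" "HOL-Algebra.Bij"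
begin

text \<open>The norm of \<open>complex ^ 'n\<close> is the Euclidean one, so \<open>ball 0 1\<close> is the open
  unit ball of \<open>n\<close>-dimensional complex space.\<close>

abbreviation unit_ball :: "(complex ^ 'n::finite) set"
  where "unit_ball \<equiv> ball 0 1"

text \<open>Holomorphic in several variables: the real Frechet derivative exists at each point and is
  complex linear, i.e. given by a complex matrix. Only used on open sets.\<close>

definition holomorphic_map_on ::
    "(complex ^ 'n::finite \<Rightarrow> complex ^ 'm::finite) \<Rightarrow> (complex ^ 'n) set \<Rightarrow> bool"
  where "holomorphic_map_on f S \<longleftrightarrow>
    (\<forall>z\<in>S. \<exists>A :: complex ^ 'n ^ 'm. (f has_derivative (\<lambda>v. A *v v)) (at z))"

definition proper_holomorphic_ball_map ::
    "(complex ^ 'n::finite \<Rightarrow> complex ^ 'm::finite) \<Rightarrow> bool"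
  where "proper_holomorphic_ball_map f \<longleftrightarrow>
    holomorphic_map_on f unit_ball \<and> f ` unit_ball \<subseteq> unit_ball \<and>
    proper_map (top_of_set unit_ball) (top_of_set unit_ball) f"

text \<open>Automorphisms are represented by functions that are \<open>undefined\<close> outside the
  ball (see \<open>Bij\<close>), so that equality in the group is equality on the ball.\<close>

definition ball_aut :: "(complex ^ 'n::finite \<Rightarrow> complex ^ 'n) monoid"
  where "ball_aut = (BijGroup unit_ball)
    \<lparr>carrier := {\<gamma> \<in> Bij unit_ball. holomorphic_map_on \<gamma> unit_ball \<and>
                                   holomorphic_map_on (inv_into unit_ball \<gamma>) unit_ball}\<rparr>"

lemma holomorphic_map_on_cong: assumes "holomorphic_map_on f S" "open S" "\<And>z. z\<in>S \<Longrightarrow> f z = g z"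
  shows "holomorphic_map_on g S"
  using assms unfolding holomorphic_map_on_def by (metis has_derivative_transform_within_open)

lemma holomorphic_map_on_comp: assumes "holomorphic_map_on f S" "holomorphic_map_on g T" "f ` S \<subseteq> T"
  shows "holomorphic_map_on (\<lambda>z. g (f z)) S"
  unfolding holomorphic_map_on_def
proof
  fix z assume z: "z\<in>S"
  obtain A where A: "(f has_derivative (\<lambda>v. A *v v)) (at z)" using assms z unfolding holomorphic_map_on_def by blast
  obtain B where B: "(g has_derivative (\<lambda>v. B *v v)) (at (f z))" using assms z unfolding holomorphic_map_on_def by blast
  show "\<exists>A. ((\<lambda>z. g (f z)) has_derivative (\<lambda>v. A *v v)) (at z)"
    using has_derivative_compose[OF A B] by (auto simp: matrix_vector_mul_assoc)
qed

lemma holomorphic_map_on_id:  "holomorphic_map_on (\<lambda>z::complex^'n::finite. z) S"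
proof -
  have "(\<lambda>v::complex^'n. mat 1 *v v) = (\<lambda>v. v)" by auto
  then show ?thesis unfolding holomorphic_map_on_def by (metis has_derivative_ident)
qed

lemma group_ball_aut: "group (ball_aut :: (complex ^ 'n::finite \<Rightarrow> complex ^ 'n) monoid)"
proof -
  interpret G: group "BijGroup (unit_ball :: (complex^'n) set)" by (rule group_BijGroup)
  let ?B = "unit_ball :: (complex^'n) set"
  let ?C = "carrier (ball_aut :: (complex ^ 'n::finite \<Rightarrow> complex ^ 'n) monoid)"
  have C: "?C = {\<gamma> \<in> Bij ?B. holomorphic_map_on \<gamma> ?B \<and> holomorphic_map_on (inv_into ?B \<gamma>) ?B}"
    by (simp add: ball_aut_def)
  have inv: "inv\<^bsub>BijGroup ?B\<^esub> f = restrict (inv_into ?B f) ?B" if "f \<in> Bij ?B" for f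
    by (rule G.inv_equality) (use that in \<open>auto simp: BijGroup_def restrict_inv_into_Bij Bij_compose_restrict_eq\<close>)
  have invinv: "inv_into ?B (restrict (inv_into ?B f) ?B) z = f z" if "f \<in> Bij ?B" "z \<in> ?B" for f z
  proof (rule inv_into_f_eq)
    show "inj_on (restrict (inv_into ?B f) ?B) ?B"
      using restrict_inv_into_Bij[OF that(1)] unfolding Bij_def bij_betw_def by blast
    show fz: "f z \<in> ?B" using Bij_imp_funcset[OF that(1)] that(2) by (rule funcset_mem)
    have "inj_on f ?B" using that(1) unfolding Bij_def bij_betw_def by blast
    then show "restrict (inv_into ?B f) ?B (f z) = z"
      using fz that(2) by (simp only: restrict_apply if_True inv_into_f_f)
  qed
  have "subgroup ?C (BijGroup ?B)"
  proof (rule G.subgroupI)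
    show "?C \<subseteq> carrier (BijGroup ?B)" unfolding C BijGroup_def by (simp only: partial_object.simps) blast
    have "restrict (\<lambda>z. z) ?B \<in> ?C"
      unfolding C
    proof (clarify, intro conjI)
      show "restrict (\<lambda>z. z) ?B \<in> Bij ?B" by (rule id_Bij)
      show "holomorphic_map_on (restrict (\<lambda>z. z) ?B) ?B" by (rule holomorphic_map_on_cong[OF holomorphic_map_on_id]) simp_all
      show "holomorphic_map_on (inv_into ?B (restrict (\<lambda>z. z) ?B)) ?B"
        by (rule holomorphic_map_on_cong[OF holomorphic_map_on_id], simp, rule sym, rule inv_into_f_eq) (simp_all add: inj_on_def)
    qed
    then show "?C \<noteq> {}" by blast
    fix f assume f: "f \<in> ?C"
    then show "inv\<^bsub>BijGroup ?B\<^esub> f \<in> ?C"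
      unfolding C using restrict_inv_into_Bij
    proof (clarify, intro conjI)
      assume a: "f \<in> Bij ?B" "holomorphic_map_on f ?B" "holomorphic_map_on (inv_into ?B f) ?B"
      show "inv\<^bsub>BijGroup ?B\<^esub> f \<in> Bij ?B" unfolding inv[OF a(1)] by (rule restrict_inv_into_Bij[OF a(1)])
      show "holomorphic_map_on (inv\<^bsub>BijGroup ?B\<^esub> f) ?B" unfolding inv[OF a(1)]
        by (rule holomorphic_map_on_cong[OF a(3)]) auto
      show "holomorphic_map_on (inv_into ?B (inv\<^bsub>BijGroup ?B\<^esub> f)) ?B" unfolding inv[OF a(1)]
        by (rule holomorphic_map_on_cong[OF a(2)]) (use invinv[OF a(1)] in auto)
    qed
    fix g assume g: "g \<in> ?C"
    have fg: "f \<in> Bij ?B" "g \<in> Bij ?B" using f g C by auto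
    have 1: "compose ?B f g \<in> Bij ?B" using fg by (rule compose_Bij)
    have 2: "holomorphic_map_on (compose ?B f g) ?B"
    proof (rule holomorphic_map_on_cong[where f="\<lambda>z. f (g z)"])
      show "holomorphic_map_on (\<lambda>z. f (g z)) ?B"
      proof (rule holomorphic_map_on_comp[where T="?B" and f=g and g=f])
        show "holomorphic_map_on g ?B" "holomorphic_map_on f ?B" using f g unfolding C by blast+
        show "g ` ?B \<subseteq> ?B" using Bij_imp_funcset[OF fg(2)] by blast
      qed
    qed (simp_all add: compose_def)
    have 3: "holomorphic_map_on (inv_into ?B (compose ?B f g)) ?B"
    proof (rule holomorphic_map_on_cong[where f="\<lambda>z. inv_into ?B g (inv_into ?B f z)"], rule holomorphic_map_on_comp[where T="?B" and f="inv_into ?B f" and g="inv_into ?B g"])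
      show "holomorphic_map_on (inv_into ?B f) ?B" "holomorphic_map_on (inv_into ?B g) ?B"
        using f g unfolding C by blast+
      show "open ?B" by simp
      show "inv_into ?B f ` ?B \<subseteq> ?B" by (rule image_subsetI) (rule Bij_inv_into_mem[OF fg(1)])
      fix z assume z: "z \<in> ?B"
      let ?w = "inv_into ?B g (inv_into ?B f z)"
      have w: "?w \<in> ?B" by (rule Bij_inv_into_mem[OF fg(2) Bij_inv_into_mem[OF fg(1) z]])
      have "compose ?B f g ?w = z"
      proof -
        have i: "f ` ?B = ?B" "g ` ?B = ?B" using fg unfolding Bij_def bij_betw_def by blast+
        have "g ?w = inv_into ?B f z" by (rule f_inv_into_f) (simp only: i Bij_inv_into_mem[OF fg(1) z])
        moreover have "f (inv_into ?B f z) = z" by (rule f_inv_into_f) (simp only: i z)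
        ultimately show ?thesis using w by (simp only: compose_def restrict_apply if_True)
      qed
      then show "?w = inv_into ?B (compose ?B f g) z"
        
      proof -
        have "inj_on (compose ?B f g) ?B" using 1 unfolding Bij_def bij_betw_def by (rule IntE) (simp only: mem_Collect_eq)
        then show ?thesis using inv_into_f_eq w \<open>compose ?B f g ?w = z\<close> by metis
      qed
    qed
    show "f \<otimes>\<^bsub>BijGroup ?B\<^esub> g \<in> ?C" using 1 2 3 fg unfolding C BijGroup_def by (simp del: mem_ball)
  qed
  then have "group (BijGroup ?B\<lparr>carrier := ?C\<rparr>)" by (rule G.subgroup_imp_group)
  then show ?thesis by (simp add: ball_aut_def)
qed

definition invariant_group ::
    "(complex ^ 'n::finite \<Rightarrow> complex ^ 'm::finite) \<Rightarrow> (complex ^ 'n \<Rightarrow> complex ^ 'n) set"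
  where "invariant_group f = {\<gamma> \<in> carrier ball_aut. \<forall>z\<in>unit_ball. f (\<gamma> z) = f z}"

definition hermitian_invariant_group ::
    "(complex ^ 'n::finite \<Rightarrow> complex ^ 'm::finite) \<Rightarrow> (complex ^ 'n \<Rightarrow> complex ^ 'n) set"
  where "hermitian_invariant_group f =
    {\<gamma> \<in> carrier ball_aut. \<exists>\<psi>\<in>carrier ball_aut. \<forall>z\<in>unit_ball. f (\<gamma> z) = \<psi> (f z)}"

definition conj_transpose :: "complex ^ 'n::finite ^ 'm::finite \<Rightarrow> complex ^ 'm ^ 'n"
  where "conj_transpose A = (\<chi> i j. cnj (A $ j $ i))"

definition unitary_matrix :: "complex ^ 'n::finite ^ 'n \<Rightarrow> bool"
  where "unitary_matrix A \<longleftrightarrow> conj_transpose A ** A = mat 1 \<and> A ** conj_transpose A = mat 1"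

definition matrix_aut :: "complex ^ 'n::finite ^ 'n \<Rightarrow> (complex ^ 'n \<Rightarrow> complex ^ 'n)"
  where "matrix_aut A = (\<lambda>z\<in>unit_ball. A *v z)"

definition unitary_group :: "(complex ^ 'n::finite \<Rightarrow> complex ^ 'n) set"
  where "unitary_group = matrix_aut ` {A. unitary_matrix A}"

definition diagonal_unitary_group :: "(complex ^ 2 \<Rightarrow> complex ^ 2) set"
  where "diagonal_unitary_group =
    matrix_aut ` {A. unitary_matrix A \<and> (\<forall>i j. i \<noteq> j \<longrightarrow> A $ i $ j = 0)}"

definition matrix2 :: "complex \<Rightarrow> complex \<Rightarrow> complex \<Rightarrow> complex \<Rightarrow> complex ^ 2 ^ 2"
  where "matrix2 a b c d = vector [vector [a, b], vector [c, d]]"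

definition primitive_root_of_unity :: "nat \<Rightarrow> complex \<Rightarrow> bool"
  where "primitive_root_of_unity n \<eta> \<longleftrightarrow> \<eta> ^ n = 1 \<and> (\<forall>k. 0 < k \<and> k < n \<longrightarrow> \<eta> ^ k \<noteq> 1)"

definition map_a :: "complex ^ 2 \<Rightarrow> complex ^ 3"
  where "map_a z = vector [z $ 1, z $ 2, 0]"

definition map_b :: "complex ^ 2 \<Rightarrow> complex ^ 3"
  where "map_b z = vector [z $ 1, z $ 1 * z $ 2, (z $ 2)\<^sup>2]"

definition map_c :: "complex ^ 2 \<Rightarrow> complex ^ 3"
  where "map_c z = vector [(z $ 1)\<^sup>2, complex_of_real (sqrt 2) * z $ 1 * z $ 2, (z $ 2)\<^sup>2]"

definition map_d :: "complex ^ 2 \<Rightarrow> complex ^ 3"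
  where "map_d z = vector [z $ 1 ^ 3, complex_of_real (sqrt 3) * z $ 1 * z $ 2, z $ 2 ^ 3]"

end

theory Submission
  imports Defs "HOL-Complex_Analysis.Conformal_Mappings"
begin

text \<open>
  If \<open>f \<circ> \<gamma> = \<psi> \<circ> f\<close> with \<open>\<psi>\<close> injective, then \<open>\<gamma>\<close> permutes the fibres of \<open>f\<close>
  (\<open>hermitian_invariant_fibres\<close>). For the three nonlinear maps this forces \<open>\<gamma> 0 = 0\<close>, because
  the fibre of \<open>0\<close> is \<open>{0}\<close>, so that the fibre through \<open>\<gamma> 0\<close> is a singleton as well. The
  quadratic and the cubic map are invariant under a unitary matrix that fixes no other point,
  and every point except \<open>0\<close> shares its fibre with another one. For the Whitney map
  \<open>(z\<^sub>1, z\<^sub>1 z\<^sub>2, z\<^sub>2\<^sup>2)\<close> the fibres with two points fill the punctured disc \<open>z\<^sub>1 = 0\<close>,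
  \<open>z\<^sub>2 \<noteq> 0\<close>, which \<open>\<gamma>\<close> must therefore preserve; by continuity \<open>\<gamma> 0\<close> has first coordinate \<open>0\<close>,
  and \<open>0\<close> is the only point of the disc \<open>z\<^sub>1 = 0\<close> whose fibre is a singleton.

  By Cartan's theorem (\<open>ball_aut_fixing_zero_unitary\<close>), an automorphism of the ball that fixes
  \<open>0\<close> is a unitary matrix, so the rest is linear algebra. A unitary matrix in \<open>\<Gamma>\<^sub>f\<close>
  preserves the axis \<open>z\<^sub>1 = 0\<close> for the Whitney map, hence is diagonal, and permutes the
  coordinate axes for the cubic map (\<open>hermitian_invariant_group_d_matrix\<close>). Conversely, the matrices in question
  act on the monomials of \<open>f\<close> by unitary matrices; for the quadratic map this is the symmetric
  square of the standard representation. The groups \<open>G\<^sub>f\<close> are then found by evaluating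
  \<open>f(Az) = f(z)\<close> at a few vectors.

  For the linear embedding, \<open>\<Gamma>\<^sub>f\<close> is a group, and the automorphism group of the two-dimensional ball is generated by the unitary
  matrices and explicit involutions that exchange \<open>0\<close> and a point of the first axis
  (\<open>ball_aut_generated\<close>). Both kinds of generators visibly extend to the larger ball.

  Properness amounts to \<open>1 - |z|\<^sup>2\<close> dividing \<open>1 - |f(z)|\<^sup>2\<close> with a positive quotient.
\<close>

section \<open>The Hermitian product and unitary matrices\<close>

definition hdot :: "complex ^ 'n::finite \<Rightarrow> complex ^ 'n \<Rightarrow> complex"
  where "hdot z w = (\<Sum>i\<in>UNIV. z $ i * cnj (w $ i))"

lemma norm_power2_eq_sum: "(norm (z :: complex ^ 'n::finite))\<^sup>2 = (\<Sum>i\<in>UNIV. (cmod (z $ i))\<^sup>2)"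
  by (simp add: norm_vec_def L2_set_def sum_nonneg)

lemma hdot_self: "hdot z z = of_real ((norm z)\<^sup>2)"
  unfolding norm_power2_eq_sum hdot_def of_real_sum
  by (rule sum.cong) (simp_all only: complex_norm_square)

lemma inner_eq_Re_hdot: "z \<bullet> w = Re (hdot z w)"
  by (simp add: hdot_def inner_vec_def inner_complex_def)

lemma hdot_scale_left: "hdot (c *s z) w = c * hdot z w"
  by (simp add: hdot_def sum_distrib_left mult.assoc)

lemma hdot_scale_right: "hdot z (c *s w) = cnj c * hdot z w"
  by (simp add: hdot_def sum_distrib_left mult_ac)

lemma hdot_commute: "hdot w z = cnj (hdot z w)"
  by (simp add: hdot_def mult_ac)

lemma hdot_diff: "hdot (z - x) w = hdot z w - hdot x w" "hdot w (z - x) = hdot w z - hdot w x"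
  by (simp_all add: hdot_def algebra_simps sum_subtractf)

lemma cmod_hdot_le: "cmod (hdot z w) \<le> norm z * norm w"
proof -
  have "cmod (hdot z w) \<le> (\<Sum>i\<in>UNIV. \<bar>cmod (z $ i)\<bar> * \<bar>cmod (w $ i)\<bar>)"
    unfolding hdot_def by (rule order_trans[OF norm_sum]) (simp add: norm_mult)
  also have "\<dots> \<le> norm z * norm w"
    unfolding norm_vec_def by (rule L2_set_mult_ineq)
  finally show ?thesis .
qed

lemma norm_scale_complex: "norm (c *s (z :: complex ^ 'n::finite)) = cmod c * norm z"
  by (simp add: norm_vec_def L2_set_def norm_mult power_mult_distrib
      flip: sum_distrib_left real_sqrt_mult) (simp add: real_sqrt_mult)

lemma scaleR_eq_scale: "r *\<^sub>R z = complex_of_real r *s (z :: complex ^ 'n::finite)"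
  unfolding vec_eq_iff vector_scaleR_component vector_smult_component
  by (simp add: scaleR_conv_of_real)

lemma hdot_matrix_left: "hdot (A *v z) w = hdot z (conj_transpose A *v w)"
proof -
  have "hdot (A *v z) w = (\<Sum>i\<in>UNIV. \<Sum>j\<in>UNIV. A $ i $ j * z $ j * cnj (w $ i))"
    by (simp add: hdot_def matrix_vector_mult_def sum_distrib_right)
  also have "\<dots> = (\<Sum>j\<in>UNIV. \<Sum>i\<in>UNIV. A $ i $ j * z $ j * cnj (w $ i))"
    by (rule sum.swap)
  also have "\<dots> = hdot z (conj_transpose A *v w)"
    by (simp add: hdot_def matrix_vector_mult_def conj_transpose_def sum_distrib_left mult_ac)
  finally show ?thesis .
qed

lemma conj_transpose_conj_transpose: "conj_transpose (conj_transpose A) = A"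
  by (simp add: conj_transpose_def vec_eq_iff)

lemma conj_transpose_mult: "conj_transpose (A ** B) = conj_transpose B ** conj_transpose A"
  by (simp add: conj_transpose_def matrix_matrix_mult_def vec_eq_iff mult_ac)

lemma conj_transpose_one: "conj_transpose (mat 1) = mat 1"
  by (simp add: conj_transpose_def mat_def vec_eq_iff)

lemma unitary_matrixI: "conj_transpose A ** A = mat 1 \<Longrightarrow> unitary_matrix A"
  by (simp add: unitary_matrix_def matrix_left_right_inverse)

lemma unitary_matrix_conj_transpose: "unitary_matrix A \<Longrightarrow> unitary_matrix (conj_transpose A)"
  by (simp add: unitary_matrix_def conj_transpose_conj_transpose)

lemma unitary_matrix_mult:
  assumes "unitary_matrix A" "unitary_matrix B"
  shows "unitary_matrix (A ** B)"
proof (rule unitary_matrixI)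
  have "conj_transpose (A ** B) ** (A ** B) = conj_transpose B ** (conj_transpose A ** A) ** B"
    by (simp add: conj_transpose_mult matrix_mul_assoc)
  then show "conj_transpose (A ** B) ** (A ** B) = mat 1"
    using assms by (simp add: unitary_matrix_def)
qed

lemma unitary_matrix_one: "unitary_matrix (mat 1)"
  by (simp add: unitary_matrix_def conj_transpose_one)

lemma unitary_matrix_norm:
  assumes "unitary_matrix A"
  shows "norm (A *v z) = norm z"
proof -
  have "hdot (A *v z) (A *v z) = hdot z z"
    using assms by (simp add: hdot_matrix_left matrix_vector_mul_assoc unitary_matrix_def)
  then have "(norm (A *v z))\<^sup>2 = (norm z)\<^sup>2"
    by (simp only: hdot_self of_real_eq_iff)
  then show ?thesis by simp
qed

text \<open>A real-linear isometry preserves the real part of the Hermitian product; multiplying one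
  argument by \<open>\<i>\<close> recovers the imaginary part.\<close>

lemma unitary_matrix_if_norm:
  fixes A :: "complex ^ 'n::finite ^ 'n"
  assumes norm: "\<And>z. norm (A *v z) = norm z"
  shows "unitary_matrix A"
proof (rule unitary_matrixI)
  have lin: "linear (\<lambda>z. A *v z)"
    by (rule linearI) (simp_all add: matrix_vector_right_distrib scaleR_eq_scale vector_scalar_commute)
  have Re: "Re (hdot (A *v z) (A *v w)) = Re (hdot z w)" for z w
    using lin norm orthogonal_transformation[of "\<lambda>z. A *v z"]
    by (auto simp: orthogonal_transformation_def inner_eq_Re_hdot)
  have Im: "Im (hdot (A *v z) (A *v w)) = Im (hdot z w)" for z w
    using Re[of "\<i> *s z" w] by (simp add: vector_scalar_commute hdot_scale_left)
  have eq: "hdot (A *v z) (A *v w) = hdot z w" for z w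
    using Re Im complex_eqI by blast
  have ax: "A *v axis i 1 = (\<chi> k. A $ k $ i)" for i
    by (simp add: vec_eq_iff matrix_vector_mult_def axis_def if_distrib cong: if_cong)
  have axd: "hdot (axis j 1) (axis i 1) = (if i = j then 1 else 0)" for i j :: 'n
    by (simp add: hdot_def axis_def if_distrib[of cnj] if_distrib[of "\<lambda>x. _ * x"] if_distrib[of "\<lambda>x. x * _"]
        sum.delta cong: if_cong)
  have "(conj_transpose A ** A) $ i $ j = mat 1 $ i $ j" for i j
  proof -
    have "(conj_transpose A ** A) $ i $ j = hdot (A *v axis j 1) (A *v axis i 1)"
      by (simp add: ax hdot_def conj_transpose_def matrix_matrix_mult_def mult.commute)
    then show ?thesis by (simp add: eq axd mat_def)
  qed
  then show "conj_transpose A ** A = mat 1" by (simp add: vec_eq_iff)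
qed

section \<open>The automorphism group of the ball\<close>

lemma holomorphic_map_onI:
  fixes f :: "complex ^ 'n::finite \<Rightarrow> complex ^ 'm::finite"
  assumes "\<And>z. z \<in> S \<Longrightarrow> (f has_derivative D z) (at z)"
    and scale: "\<And>z c v. z \<in> S \<Longrightarrow> D z (c *s v) = c *s D z v"
  shows "holomorphic_map_on f S"
  unfolding holomorphic_map_on_def
proof
  fix z assume z: "z \<in> S"
  have "linear (D z)" using assms(1)[OF z] by (rule has_derivative_linear)
  then have "Vector_Spaces.linear (*s) (*s) (D z)"
    unfolding Vector_Spaces.linear_iff using scale[OF z]
    by (simp add: vec.vector_space_axioms linear_add)
  then have "D z = (\<lambda>v. matrix (D z) *v v)" by (simp add: matrix_works)
  then show "\<exists>A. (f has_derivative (\<lambda>v. A *v v)) (at z)"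
    using assms(1)[OF z] by metis
qed

lemma bounded_linear_matrix_vector: "bounded_linear (\<lambda>z. (A :: complex ^ 'n::finite ^ 'm::finite) *v z)"
  by (intro linear_conv_bounded_linear[THEN iffD1] linearI)
    (simp_all add: matrix_vector_right_distrib scaleR_eq_scale vector_scalar_commute)

lemma holomorphic_map_on_matrix: "holomorphic_map_on (\<lambda>z. A *v z) S"
  unfolding holomorphic_map_on_def
  using bounded_linear_imp_has_derivative[OF bounded_linear_matrix_vector] by blast

lemma carrier_ball_aut:
  "carrier ball_aut = {\<gamma> \<in> Bij unit_ball. holomorphic_map_on \<gamma> unit_ball \<and>
     holomorphic_map_on (inv_into unit_ball \<gamma>) unit_ball}"
  by (simp add: ball_aut_def)

lemma one_ball_aut: "\<one>\<^bsub>ball_aut\<^esub> = (\<lambda>z\<in>unit_ball. z)"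
  by (simp add: ball_aut_def BijGroup_def)

lemma mult_ball_aut:
  assumes "\<gamma> \<in> carrier ball_aut" "\<delta> \<in> carrier ball_aut"
  shows "\<gamma> \<otimes>\<^bsub>ball_aut\<^esub> \<delta> = (\<lambda>z\<in>unit_ball. \<gamma> (\<delta> z))"
  using assms by (simp add: carrier_ball_aut ball_aut_def BijGroup_def compose_def)

lemma ball_aut_mem: "\<gamma> \<in> carrier ball_aut \<Longrightarrow> z \<in> unit_ball \<Longrightarrow> \<gamma> z \<in> unit_ball"
  using Bij_imp_funcset by (fastforce simp: carrier_ball_aut simp del: mem_ball)

lemma ball_aut_inj:
  "\<gamma> \<in> carrier ball_aut \<Longrightarrow> z \<in> unit_ball \<Longrightarrow> w \<in> unit_ball \<Longrightarrow> \<gamma> z = \<gamma> w \<longleftrightarrow> z = w"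
  by (auto simp: carrier_ball_aut Bij_def bij_betw_def inj_on_def)

lemma ball_aut_surj: "\<gamma> \<in> carrier ball_aut \<Longrightarrow> z \<in> unit_ball \<Longrightarrow> \<exists>w\<in>unit_ball. \<gamma> w = z"
  unfolding carrier_ball_aut Bij_def bij_betw_def by (blast elim: equalityE)

lemma ball_aut_ext: "\<gamma> \<in> carrier ball_aut \<Longrightarrow> restrict \<gamma> unit_ball = \<gamma>"
  by (auto simp: carrier_ball_aut Bij_def extensional_restrict)

lemma ball_aut_holomorphic: "\<gamma> \<in> carrier ball_aut \<Longrightarrow> holomorphic_map_on \<gamma> unit_ball"
  by (simp add: carrier_ball_aut)

lemma inv_ball_aut_apply:
  assumes "\<gamma> \<in> carrier ball_aut" "z \<in> unit_ball"
  shows "(inv\<^bsub>ball_aut\<^esub> \<gamma>) (\<gamma> z) = z" "\<gamma> ((inv\<^bsub>ball_aut\<^esub> \<gamma>) z) = z"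
proof -
  interpret group ball_aut by (rule group_ball_aut)
  have i: "inv\<^bsub>ball_aut\<^esub> \<gamma> \<in> carrier ball_aut" using assms by simp
  show "(inv\<^bsub>ball_aut\<^esub> \<gamma>) (\<gamma> z) = z"
    using fun_cong[OF l_inv[OF assms(1)], of z] assms i by (simp add: mult_ball_aut one_ball_aut)
  show "\<gamma> ((inv\<^bsub>ball_aut\<^esub> \<gamma>) z) = z"
    using fun_cong[OF r_inv[OF assms(1)], of z] assms i by (simp add: mult_ball_aut one_ball_aut)
qed

lemma restrict_in_ball_aut:
  assumes f: "\<And>z. z \<in> unit_ball \<Longrightarrow> f z \<in> unit_ball" "holomorphic_map_on f unit_ball"
    and g: "\<And>z. z \<in> unit_ball \<Longrightarrow> g z \<in> unit_ball" "holomorphic_map_on g unit_ball"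
    and inv: "\<And>z. z \<in> unit_ball \<Longrightarrow> g (f z) = z" "\<And>z. z \<in> unit_ball \<Longrightarrow> f (g z) = z"
  shows "restrict f unit_ball \<in> carrier ball_aut"
proof -
  have bij: "bij_betw (restrict f unit_ball) unit_ball unit_ball"
    using f(1) g(1) inv by (intro bij_betw_byWitness[where f' = g]) (auto simp del: mem_ball)
  have hol: "holomorphic_map_on (restrict f unit_ball) unit_ball"
    by (rule holomorphic_map_on_cong[OF f(2)]) simp_all
  have "holomorphic_map_on (inv_into unit_ball (restrict f unit_ball)) unit_ball"
  proof (rule holomorphic_map_on_cong[OF g(2)])
    fix z :: "complex ^ 'a" assume z: "z \<in> unit_ball"
    show "g z = inv_into unit_ball (restrict f unit_ball) z"
      by (rule sym, rule inv_into_f_eq)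
        (use z g(1) inv bij in \<open>auto simp: bij_betw_def simp del: mem_ball\<close>)
  qed simp
  then show ?thesis
    using bij hol by (auto simp: carrier_ball_aut Bij_def)
qed

lemma matrix_aut_in_ball_aut:
  assumes "unitary_matrix A"
  shows "matrix_aut A \<in> carrier ball_aut"
  unfolding matrix_aut_def
  by (rule restrict_in_ball_aut[where g = "\<lambda>z. conj_transpose A *v z"])
    (use assms unitary_matrix_norm[OF assms] unitary_matrix_norm[OF unitary_matrix_conj_transpose[OF assms]]
      in \<open>simp_all add: holomorphic_map_on_matrix matrix_vector_mul_assoc unitary_matrix_def\<close>)

lemma matrix_aut_mult:
  assumes "unitary_matrix A" "unitary_matrix B"
  shows "matrix_aut A \<otimes>\<^bsub>ball_aut\<^esub> matrix_aut B = matrix_aut (A ** B)"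
  unfolding mult_ball_aut[OF matrix_aut_in_ball_aut[OF assms(1)] matrix_aut_in_ball_aut[OF assms(2)]]
  using unitary_matrix_norm[OF assms(2)]
  by (auto simp: matrix_aut_def matrix_vector_mul_assoc intro!: restrict_ext)

lemma matrix_aut_one: "matrix_aut (mat 1) = \<one>\<^bsub>ball_aut\<^esub>"
  by (simp add: matrix_aut_def one_ball_aut)

lemma matrix_aut_inv:
  assumes "unitary_matrix A"
  shows "inv\<^bsub>ball_aut\<^esub> (matrix_aut A) = matrix_aut (conj_transpose A)"
proof -
  interpret group ball_aut by (rule group_ball_aut)
  show ?thesis
    using assms unitary_matrix_conj_transpose[OF assms]
    by (intro inv_equality)
      (simp_all add: matrix_aut_in_ball_aut matrix_aut_mult unitary_matrix_def matrix_aut_one)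
qed

lemma subgroup_unitary_group: "subgroup unitary_group ball_aut"
proof -
  interpret group ball_aut by (rule group_ball_aut)
  show ?thesis
    by (rule subgroupI)
      (auto simp: unitary_group_def matrix_aut_in_ball_aut matrix_aut_inv matrix_aut_mult
        intro!: imageI unitary_matrix_one unitary_matrix_conj_transpose unitary_matrix_mult)
qed

lemma matrix_aut_inject:
  assumes "matrix_aut A = matrix_aut B"
  shows "A = B"
proof -
  have "A *v z = B *v z" for z
  proof -
    define r where "r = 1 / (norm z + 1)"
    have r: "r > 0" "norm z * r < 1" by (simp_all add: r_def add_nonneg_pos)
    then have "complex_of_real r *s z \<in> unit_ball" by (simp add: norm_scale_complex mult.commute)
    then have "A *v (complex_of_real r *s z) = B *v (complex_of_real r *s z)"
      using fun_cong[OF assms, of "complex_of_real r *s z"] by (simp add: matrix_aut_def)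
    then show ?thesis using r(1) by (simp add: vector_scalar_commute)
  qed
  then show ?thesis by (simp add: matrix_eq)
qed

section \<open>Automorphisms fixing the origin\<close>

lemma holomorphic_on_disc_slice:
  fixes \<gamma> :: "complex ^ 'n::finite \<Rightarrow> complex ^ 'm::finite"
  assumes "holomorphic_map_on \<gamma> unit_ball" "norm u = 1"
  shows "(\<lambda>t. hdot (\<gamma> (t *s u)) w) holomorphic_on ball 0 1"
proof -
  have "(\<lambda>t. hdot (\<gamma> (t *s u)) w) field_differentiable (at t)" if "t \<in> ball 0 1" for t
  proof -
    have "t *s u \<in> unit_ball" using that assms(2) by (simp add: norm_scale_complex)
    then obtain A where A: "(\<gamma> has_derivative (\<lambda>v. A *v v)) (at (t *s u))"
      using assms(1) unfolding holomorphic_map_on_def by blast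
    have "bounded_linear (\<lambda>t. t *s u)"
      by (intro linear_conv_bounded_linear[THEN iffD1] linearI)
        (simp_all add: vector_sadd_rdistrib scaleR_eq_scale scaleR_conv_of_real vector_smult_assoc)
    then have s: "((\<lambda>t. t *s u) has_derivative (\<lambda>v. v *s u)) (at t)"
      by (rule bounded_linear_imp_has_derivative)
    have "bounded_linear (\<lambda>z. hdot z w)"
      by (intro linear_conv_bounded_linear[THEN iffD1] linearI)
        (simp_all add: hdot_def distrib_right sum.distrib scaleR_sum_right)
    then have h: "((\<lambda>z. hdot z w) has_derivative (\<lambda>z. hdot z w)) F" for F
      by (rule bounded_linear_imp_has_derivative)
    have "((\<lambda>t. hdot (\<gamma> (t *s u)) w) has_derivative (\<lambda>v. hdot (A *v (v *s u)) w)) (at t)"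
      using has_derivative_compose[OF has_derivative_compose[OF s A] h] .
    then have "((\<lambda>t. hdot (\<gamma> (t *s u)) w) has_derivative (*) (hdot (A *v u) w)) (at t)"
      by (simp add: vector_scalar_commute hdot_scale_left mult.commute[of _ "hdot (A *v u) w"])
    then show ?thesis
      unfolding field_differentiable_def has_field_derivative_def by blast
  qed
  then show ?thesis
    by (simp add: holomorphic_on_def field_differentiable_at_within)
qed

text \<open>The Schwarz lemma on the ball reduces to the one-variable lemma for the component of \<open>\<gamma>\<close>
  in a direction \<open>w\<close> along the disc through a unit vector \<open>u\<close>. The choice \<open>u = z / |z|\<close>,
  \<open>w = \<gamma> z / |\<gamma> z|\<close> controls \<open>|\<gamma> z|\<close>.\<close>

lemma Schwarz_slice:
  fixes \<gamma> :: "complex ^ 'n::finite \<Rightarrow> complex ^ 'm::finite"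
  assumes hol: "holomorphic_map_on \<gamma> unit_ball"
    and ball: "\<And>z. z \<in> unit_ball \<Longrightarrow> \<gamma> z \<in> unit_ball"
    and zero: "\<gamma> 0 = 0" and u: "norm u = 1" and w: "norm w = 1"
  defines "g \<equiv> (\<lambda>t. hdot (\<gamma> (t *s u)) w)"
  shows "cmod t < 1 \<Longrightarrow> cmod (g t) \<le> cmod t"
    and "\<lbrakk>cmod \<mu> < 1; \<mu> \<noteq> 0; g \<mu> = \<mu>; cmod t < 1\<rbrakk> \<Longrightarrow> g t = t"
proof -
  have g: "g holomorphic_on ball 0 1"
    unfolding g_def using hol u by (rule holomorphic_on_disc_slice)
  have g0: "g 0 = 0" by (simp add: g_def zero hdot_def)
  have g1: "cmod (g t) < 1" if "cmod t < 1" for t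
  proof -
    have "cmod (g t) \<le> norm (\<gamma> (t *s u)) * norm w"
      unfolding g_def by (rule cmod_hdot_le)
    also have "\<dots> < 1" using ball[of "t *s u"] that u w by (simp add: norm_scale_complex)
    finally show ?thesis .
  qed
  show "cmod (g t) \<le> cmod t" if "cmod t < 1"
    using Schwarz_Lemma(1)[OF g g0 g1 that] by simp
  assume *: "cmod \<mu> < 1" "\<mu> \<noteq> 0" "g \<mu> = \<mu>" "cmod t < 1"
  then obtain \<alpha> where \<alpha>: "\<And>z. cmod z < 1 \<Longrightarrow> g z = \<alpha> * z"
    using Schwarz_Lemma(3)[OF g g0 g1 *(1)] by metis
  with * have "\<alpha> = 1" by (metis mult_cancel_right2)
  with \<alpha> * show "g t = t" by simp
qed

lemma norm_image_le:
  fixes \<gamma> :: "complex ^ 'n::finite \<Rightarrow> complex ^ 'm::finite"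
  assumes hol: "holomorphic_map_on \<gamma> unit_ball"
    and ball: "\<And>z. z \<in> unit_ball \<Longrightarrow> \<gamma> z \<in> unit_ball"
    and zero: "\<gamma> 0 = 0" and z: "z \<in> unit_ball"
  shows "norm (\<gamma> z) \<le> norm z"
proof (cases "\<gamma> z = 0")
  case False
  then have "z \<noteq> 0" using zero by auto
  define u where "u = complex_of_real (inverse (norm z)) *s z"
  define w where "w = complex_of_real (inverse (norm (\<gamma> z))) *s \<gamma> z"
  have u: "norm u = 1" and w: "norm w = 1"
    using False \<open>z \<noteq> 0\<close> by (simp_all add: u_def w_def norm_scale_complex norm_inverse)
  have zu: "complex_of_real (norm z) *s u = z" using \<open>z \<noteq> 0\<close> by (simp add: u_def)
  have "hdot (\<gamma> z) w = of_real (norm (\<gamma> z))"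
    using False by (simp add: w_def hdot_scale_right hdot_self power2_eq_square)
  then show ?thesis
    using Schwarz_slice(1)[OF hol ball zero u w, of "of_real (norm z)"] z zu by simp
qed simp

text \<open>Cartan's theorem. By the Schwarz lemma for \<open>\<gamma>\<close> and its inverse, \<open>\<gamma>\<close> preserves norms.
  Equality in the one-variable Schwarz lemma then makes \<open>\<gamma>\<close> homogeneous on each disc through
  \<open>0\<close>, and a homogeneous map coincides with its derivative at \<open>0\<close>.\<close>

theorem ball_aut_fixing_zero_unitary:
  assumes \<gamma>: "\<gamma> \<in> carrier ball_aut" and zero: "\<gamma> 0 = 0"
  obtains A where "unitary_matrix A" "\<gamma> = matrix_aut A"
proof -
  interpret group ball_aut by (rule group_ball_aut)
  have hol: "holomorphic_map_on \<gamma> unit_ball" by (rule ball_aut_holomorphic[OF \<gamma>])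
  have ball: "\<And>z. z \<in> unit_ball \<Longrightarrow> \<gamma> z \<in> unit_ball" by (rule ball_aut_mem[OF \<gamma>])
  let ?\<delta> = "inv\<^bsub>ball_aut\<^esub> \<gamma>"
  have \<delta>: "?\<delta> \<in> carrier ball_aut" using \<gamma> by simp
  have \<delta>0: "?\<delta> 0 = 0" using inv_ball_aut_apply(1)[OF \<gamma>, of 0] zero by simp
  have norm: "norm (\<gamma> z) = norm z" if z: "z \<in> unit_ball" for z
  proof (rule antisym)
    show "norm (\<gamma> z) \<le> norm z" by (rule norm_image_le[OF hol ball zero z])
    show "norm z \<le> norm (\<gamma> z)"
      using norm_image_le[OF ball_aut_holomorphic[OF \<delta>] ball_aut_mem[OF \<delta>] \<delta>0 ball[OF z]]
        inv_ball_aut_apply(1)[OF \<gamma> z] by simp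
  qed
  have hom: "\<gamma> (\<mu> *s z) = \<mu> *s \<gamma> z" if z: "z \<in> unit_ball" and \<mu>: "cmod \<mu> \<le> 1" for \<mu> z
  proof (cases "z = 0")
    case False
    define u where "u = complex_of_real (inverse (norm z)) *s z"
    define w where "w = complex_of_real (inverse (norm z)) *s \<gamma> z"
    have u: "norm u = 1" and w: "norm w = 1"
      using False norm[OF z] by (simp_all add: u_def w_def norm_scale_complex norm_inverse)
    have zu: "complex_of_real (norm z) *s u = z" using False by (simp add: u_def)
    have zw: "complex_of_real (norm z) *s w = \<gamma> z" using False by (simp add: w_def)
    have gz: "hdot (\<gamma> (of_real (norm z) *s u)) w = of_real (norm z)"
      unfolding zu using False norm[OF z] by (simp add: w_def hdot_scale_right hdot_self power2_eq_square)
    define t where "t = \<mu> * of_real (norm z)"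
    have t: "cmod t < 1"
      using \<mu> z mult_mono[of "cmod \<mu>" 1 "norm z" "norm z"] by (simp add: t_def norm_mult)
    have gl: "hdot (\<gamma> (t *s u)) w = t"
      using Schwarz_slice(2)[OF hol ball zero u w _ _ gz t] False z by simp
    have nl: "norm (\<gamma> (t *s u)) = cmod t"
      using norm[of "t *s u"] t u by (simp add: norm_scale_complex)
    have wg: "hdot w (\<gamma> (t *s u)) = cnj t"
      using gl hdot_commute[of w] by simp
    have "hdot (\<gamma> (t *s u) - t *s w) (\<gamma> (t *s u) - t *s w) = 0"
      unfolding hdot_diff using gl nl w wg
      by (simp add: hdot_scale_left hdot_scale_right hdot_self norm_scale_complex mult.commute flip: complex_norm_square)
    then have "\<gamma> (t *s u) = t *s w" by (simp add: hdot_self)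
    moreover have "t *s u = \<mu> *s z" "t *s w = \<mu> *s \<gamma> z"
      by (simp_all add: t_def zu zw flip: vector_smult_assoc)
    ultimately show ?thesis by simp
  qed (simp add: zero)
  obtain A where A: "(\<gamma> has_derivative (\<lambda>v. A *v v)) (at 0)"
    using hol unfolding holomorphic_map_on_def by force
  have lin: "\<gamma> z = A *v z" if z: "z \<in> unit_ball" for z
  proof -
    have "((\<lambda>t::real. t *\<^sub>R z) has_derivative (\<lambda>t. t *\<^sub>R z)) (at 0)"
      by (intro bounded_linear_imp_has_derivative bounded_linear_scaleR_left)
    then have "((\<lambda>t::real. \<gamma> (t *\<^sub>R z)) has_derivative (\<lambda>t. A *v (t *\<^sub>R z))) (at 0)"
      using has_derivative_compose[of "\<lambda>t::real. t *\<^sub>R z" "\<lambda>t. t *\<^sub>R z" 0 UNIV \<gamma> "\<lambda>v. A *v v"] A by simp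
    then have 1: "((\<lambda>t::real. \<gamma> (t *\<^sub>R z)) has_derivative (\<lambda>t. t *\<^sub>R (A *v z))) (at 0)"
      by (simp add: scaleR_eq_scale vector_scalar_commute)
    have "((\<lambda>t::real. t *\<^sub>R \<gamma> z) has_derivative (\<lambda>t. t *\<^sub>R \<gamma> z)) (at 0)"
      by (intro bounded_linear_imp_has_derivative bounded_linear_scaleR_left)
    then have 2: "((\<lambda>t::real. \<gamma> (t *\<^sub>R z)) has_derivative (\<lambda>t. t *\<^sub>R \<gamma> z)) (at 0)"
      by (rule has_derivative_transform_within_open[OF _ open_ball[of 0 1]])
        (use hom[OF z] in \<open>simp_all add: scaleR_eq_scale\<close>)
    show ?thesis using fun_cong[OF has_derivative_unique[OF 1 2], of 1] by simp
  qed
  have "norm (A *v z) = norm z" for z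
  proof -
    define r where "r = 1 / (norm z + 1)"
    have r: "r > 0" "norm z * r < 1" by (simp_all add: r_def add_nonneg_pos)
    then have b: "complex_of_real r *s z \<in> unit_ball" by (simp add: norm_scale_complex mult.commute)
    show ?thesis
      using norm[OF b] lin[OF b] r(1) by (simp add: vector_scalar_commute norm_scale_complex)
  qed
  then have "unitary_matrix A" by (rule unitary_matrix_if_norm)
  moreover have "\<gamma> = matrix_aut A"
    using lin ball_aut_ext[OF \<gamma>] unfolding matrix_aut_def by (metis restrict_ext)
  ultimately show ?thesis by (rule that)
qed

section \<open>Invariant groups of an arbitrary map\<close>

lemma subgroup_invariant_group: "subgroup (invariant_group f) ball_aut"
proof -
  interpret group ball_aut by (rule group_ball_aut)
  show ?thesis
  proof (rule subgroupI)
    have "\<one>\<^bsub>ball_aut\<^esub> \<in> invariant_group f"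
      by (simp add: invariant_group_def one_closed) (simp add: one_ball_aut)
    then show "invariant_group f \<noteq> {}" by blast
    fix \<gamma> assume \<gamma>: "\<gamma> \<in> invariant_group f"
    then have \<gamma>': "\<gamma> \<in> carrier ball_aut" and inv: "\<And>z. z \<in> unit_ball \<Longrightarrow> f (\<gamma> z) = f z"
      by (simp_all add: invariant_group_def)
    have "f ((inv\<^bsub>ball_aut\<^esub> \<gamma>) z) = f z" if "z \<in> unit_ball" for z
      using inv[OF ball_aut_mem[OF inv_closed[OF \<gamma>'] that]] inv_ball_aut_apply(2)[OF \<gamma>' that] by simp
    then show "inv\<^bsub>ball_aut\<^esub> \<gamma> \<in> invariant_group f"
      using \<gamma>' by (simp add: invariant_group_def)
    fix \<delta> assume "\<delta> \<in> invariant_group f"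
    then have \<delta>': "\<delta> \<in> carrier ball_aut" and inv': "\<And>z. z \<in> unit_ball \<Longrightarrow> f (\<delta> z) = f z"
      by (simp_all add: invariant_group_def)
    have "f ((\<gamma> \<otimes>\<^bsub>ball_aut\<^esub> \<delta>) z) = f z" if z: "z \<in> unit_ball" for z
      using z inv[OF ball_aut_mem[OF \<delta>' z]] inv'[OF z] by (simp add: mult_ball_aut[OF \<gamma>' \<delta>'])
    then show "\<gamma> \<otimes>\<^bsub>ball_aut\<^esub> \<delta> \<in> invariant_group f"
      unfolding invariant_group_def using m_closed[OF \<gamma>' \<delta>'] by blast
  qed (auto simp: invariant_group_def)
qed

lemma subgroup_hermitian_invariant_group:
  fixes f :: "complex ^ 'n::finite \<Rightarrow> complex ^ 'm::finite"
  assumes ball: "f ` unit_ball \<subseteq> unit_ball"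
  shows "subgroup (hermitian_invariant_group f) ball_aut"
proof -
  interpret group "ball_aut :: (complex ^ 'n \<Rightarrow> complex ^ 'n) monoid" by (rule group_ball_aut)
  interpret T: group "ball_aut :: (complex ^ 'm \<Rightarrow> complex ^ 'm) monoid" by (rule group_ball_aut)
  have fb: "f z \<in> unit_ball" if "z \<in> unit_ball" for z using ball that by blast
  show ?thesis
  proof (rule subgroupI)
    have "\<one>\<^bsub>ball_aut\<^esub> \<in> hermitian_invariant_group f"
      unfolding hermitian_invariant_group_def
      using fb by (auto intro!: bexI[of _ "\<one>\<^bsub>ball_aut\<^esub>"] simp: one_ball_aut[symmetric])
        (simp add: one_ball_aut)
    then show "hermitian_invariant_group f \<noteq> {}" by blast
    fix \<gamma> assume "\<gamma> \<in> hermitian_invariant_group f"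
    then obtain \<psi> where \<gamma>: "\<gamma> \<in> carrier ball_aut" and \<psi>: "\<psi> \<in> carrier ball_aut"
      and eq: "\<And>z. z \<in> unit_ball \<Longrightarrow> f (\<gamma> z) = \<psi> (f z)"
      by (auto simp: hermitian_invariant_group_def)
    have "f ((inv\<^bsub>ball_aut\<^esub> \<gamma>) z) = (inv\<^bsub>ball_aut\<^esub> \<psi>) (f z)" if z: "z \<in> unit_ball" for z
    proof -
      have w: "(inv\<^bsub>ball_aut\<^esub> \<gamma>) z \<in> unit_ball" using ball_aut_mem[OF inv_closed[OF \<gamma>] z] .
      show ?thesis
        using eq[OF w] inv_ball_aut_apply(1)[OF \<psi> fb[OF w]] inv_ball_aut_apply(2)[OF \<gamma> z] by simp
    qed
    then show "inv\<^bsub>ball_aut\<^esub> \<gamma> \<in> hermitian_invariant_group f"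
      using \<gamma> \<psi> by (auto simp: hermitian_invariant_group_def intro!: bexI[of _ "inv\<^bsub>ball_aut\<^esub> \<psi>"])
    fix \<delta> assume "\<delta> \<in> hermitian_invariant_group f"
    then obtain \<omega> where \<delta>: "\<delta> \<in> carrier ball_aut" and \<omega>: "\<omega> \<in> carrier ball_aut"
      and eq': "\<And>z. z \<in> unit_ball \<Longrightarrow> f (\<delta> z) = \<omega> (f z)"
      by (auto simp: hermitian_invariant_group_def)
    have "f ((\<gamma> \<otimes>\<^bsub>ball_aut\<^esub> \<delta>) z) = (\<psi> \<otimes>\<^bsub>ball_aut\<^esub> \<omega>) (f z)" if z: "z \<in> unit_ball" for z
      using z eq[OF ball_aut_mem[OF \<delta> z]] eq'[OF z] fb[OF z]
      by (simp add: mult_ball_aut[OF \<gamma> \<delta>] mult_ball_aut[OF \<psi> \<omega>])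
    then show "\<gamma> \<otimes>\<^bsub>ball_aut\<^esub> \<delta> \<in> hermitian_invariant_group f"
      unfolding hermitian_invariant_group_def using m_closed[OF \<gamma> \<delta>] T.m_closed[OF \<psi> \<omega>] by blast
  qed (auto simp: hermitian_invariant_group_def)
qed

lemma invariant_group_subset_hermitian:
  assumes "f ` unit_ball \<subseteq> unit_ball"
  shows "invariant_group f \<subseteq> hermitian_invariant_group f"
proof -
  interpret T: group ball_aut by (rule group_ball_aut)
  have "\<And>z. z \<in> unit_ball \<Longrightarrow> f z \<in> unit_ball" using assms by blast
  then show ?thesis
    unfolding invariant_group_def hermitian_invariant_group_def
    by (auto intro!: bexI[OF _ T.one_closed] simp: one_ball_aut)
qed

lemma matrix_aut_in_hermitian_invariant_group:
  assumes "unitary_matrix A" "unitary_matrix M" "f ` unit_ball \<subseteq> unit_ball"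
    and "\<And>z. f (A *v z) = M *v f z"
  shows "matrix_aut A \<in> hermitian_invariant_group f"
proof -
  have "\<And>z. z \<in> unit_ball \<Longrightarrow> f z \<in> unit_ball" using assms(3) by blast
  then show ?thesis
    using assms matrix_aut_in_ball_aut[OF assms(1)]
    unfolding hermitian_invariant_group_def
    by (auto intro!: bexI[OF _ matrix_aut_in_ball_aut[OF assms(2)]] simp: matrix_aut_def)
qed

text \<open>Since \<open>\<psi>\<close> is injective, \<open>f \<circ> \<gamma> = \<psi> \<circ> f\<close> implies that \<open>\<gamma>\<close> permutes the fibres of \<open>f\<close>. This
  forgets \<open>\<psi>\<close>, but turns out to be all the information needed to bound the Hermitian invariant
  groups from above.\<close>

lemma hermitian_invariant_fibres:
  assumes "\<gamma> \<in> hermitian_invariant_group f" "f ` unit_ball \<subseteq> unit_ball"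
    and "z \<in> unit_ball" "w \<in> unit_ball"
  shows "f (\<gamma> z) = f (\<gamma> w) \<longleftrightarrow> f z = f w"
proof -
  obtain \<psi> where \<psi>: "\<psi> \<in> carrier ball_aut" and eq: "\<And>z. z \<in> unit_ball \<Longrightarrow> f (\<gamma> z) = \<psi> (f z)"
    using assms(1) by (auto simp: hermitian_invariant_group_def)
  show ?thesis
    unfolding eq[OF assms(3)] eq[OF assms(4)]
    by (rule ball_aut_inj[OF \<psi>]) (use assms in blast)+
qed

lemma hermitian_invariant_singleton_fibre:
  assumes "\<gamma> \<in> hermitian_invariant_group f" "f ` unit_ball \<subseteq> unit_ball"
    and single: "\<And>z. z \<in> unit_ball \<Longrightarrow> f z = f 0 \<Longrightarrow> z = 0"
    and "y \<in> unit_ball" "f y = f (\<gamma> 0)"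
  shows "y = \<gamma> 0"
proof -
  have "\<gamma> \<in> carrier ball_aut" using assms(1) by (simp add: hermitian_invariant_group_def)
  then obtain w where "w \<in> unit_ball" "\<gamma> w = y" using assms(4) ball_aut_surj by blast
  with assms hermitian_invariant_fibres[of \<gamma> f w 0] show ?thesis by auto
qed

text \<open>If \<open>f\<close> is invariant under a map without fixed points other than \<open>0\<close>, then \<open>0\<close> is the only point
  that can be alone in its fibre, so it is fixed by every \<open>\<gamma>\<close> that permutes fibres.\<close>

lemma hermitian_invariant_group_subset_unitary:
  assumes ball: "f ` unit_ball \<subseteq> unit_ball"
    and single: "\<And>z. z \<in> unit_ball \<Longrightarrow> f z = f 0 \<Longrightarrow> z = 0"
    and \<sigma>: "\<And>z. z \<in> unit_ball \<Longrightarrow> \<sigma> z \<in> unit_ball" "\<And>z. z \<in> unit_ball \<Longrightarrow> f (\<sigma> z) = f z"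
    and fixed: "\<And>z. \<sigma> z = z \<Longrightarrow> z = 0"
  shows "hermitian_invariant_group f \<subseteq> unitary_group"
proof
  fix \<gamma> assume \<gamma>: "\<gamma> \<in> hermitian_invariant_group f"
  then have \<gamma>': "\<gamma> \<in> carrier ball_aut" by (simp add: hermitian_invariant_group_def)
  have p: "\<gamma> 0 \<in> unit_ball" using ball_aut_mem[OF \<gamma>', of 0] by simp
  have "\<sigma> (\<gamma> 0) = \<gamma> 0"
    by (rule hermitian_invariant_singleton_fibre[OF \<gamma> ball single \<sigma>(1)[OF p] \<sigma>(2)[OF p]])
  then have "\<gamma> 0 = 0" by (rule fixed)
  then show "\<gamma> \<in> unitary_group"
    using ball_aut_fixing_zero_unitary[OF \<gamma>'] by (metis imageI mem_Collect_eq unitary_group_def)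
qed

section \<open>Holomorphic functions of several variables\<close>

definition holomorphic_fun_on :: "(complex ^ 'n::finite \<Rightarrow> complex) \<Rightarrow> (complex ^ 'n) set \<Rightarrow> bool"
  where "holomorphic_fun_on f S \<longleftrightarrow>
    (\<forall>z\<in>S. \<exists>D. (f has_derivative D) (at z) \<and> (\<forall>c v. D (c *s v) = c * D v))"

lemma has_derivative_vec:
  fixes f :: "'a::real_normed_vector \<Rightarrow> complex ^ 'm::finite"
  assumes "\<And>i. ((\<lambda>z. f z $ i) has_derivative (\<lambda>v. D v $ i)) (at z)"
  shows "(f has_derivative D) (at z)"
  unfolding has_derivative_componentwise_within[of f]
  using assms by (auto simp: Basis_vec_def inner_axis intro: has_derivative_inner_left)

lemma holomorphic_map_on_components:
  assumes "\<And>i. holomorphic_fun_on (\<lambda>z. f z $ i) S"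
  shows "holomorphic_map_on f S"
proof -
  have "\<forall>i z. \<exists>D. z \<in> S \<longrightarrow> ((\<lambda>z. f z $ i) has_derivative D) (at z) \<and> (\<forall>c v. D (c *s v) = c * D v)"
    using assms unfolding holomorphic_fun_on_def by metis
  then obtain D where D: "\<And>i z. z \<in> S \<Longrightarrow> ((\<lambda>z. f z $ i) has_derivative D i z) (at z)"
    "\<And>i z c v. z \<in> S \<Longrightarrow> D i z (c *s v) = c * D i z v"
    by metis
  show ?thesis
    by (rule holomorphic_map_onI[where D = "\<lambda>z v. \<chi> i. D i z v"])
      (use D in \<open>auto simp: vec_eq_iff intro!: has_derivative_vec\<close>)
qed

lemma holomorphic_fun_on_const: "holomorphic_fun_on (\<lambda>z. c) S"
  unfolding holomorphic_fun_on_def by (auto intro!: exI[of _ "\<lambda>v. 0"])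

lemma holomorphic_fun_on_component: "holomorphic_fun_on (\<lambda>z. z $ i) S"
  unfolding holomorphic_fun_on_def
  by (auto intro!: exI[of _ "\<lambda>v. v $ i"] bounded_linear_imp_has_derivative bounded_linear_vec_nth)

lemma holomorphic_fun_on_diff:
  assumes "holomorphic_fun_on f S" "holomorphic_fun_on g S"
  shows "holomorphic_fun_on (\<lambda>z. f z - g z) S"
  unfolding holomorphic_fun_on_def
proof
  fix z assume "z \<in> S"
  then obtain D E where D: "(f has_derivative D) (at z)" "\<forall>c v. D (c *s v) = c * D v"
    and E: "(g has_derivative E) (at z)" "\<forall>c v. E (c *s v) = c * E v"
    using assms unfolding holomorphic_fun_on_def by meson
  show "\<exists>D. ((\<lambda>z. f z - g z) has_derivative D) (at z) \<and> (\<forall>c v. D (c *s v) = c * D v)"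
    by (rule exI, rule conjI, rule has_derivative_diff[OF D(1) E(1)])
      (simp add: D(2) E(2) algebra_simps)
qed

lemma holomorphic_fun_on_mult:
  assumes "holomorphic_fun_on f S" "holomorphic_fun_on g S"
  shows "holomorphic_fun_on (\<lambda>z. f z * g z) S"
  unfolding holomorphic_fun_on_def
proof
  fix z assume "z \<in> S"
  then obtain D E where D: "(f has_derivative D) (at z)" "\<forall>c v. D (c *s v) = c * D v"
    and E: "(g has_derivative E) (at z)" "\<forall>c v. E (c *s v) = c * E v"
    using assms unfolding holomorphic_fun_on_def by meson
  show "\<exists>D. ((\<lambda>z. f z * g z) has_derivative D) (at z) \<and> (\<forall>c v. D (c *s v) = c * D v)"
    by (rule exI, rule conjI, rule has_derivative_mult[OF D(1) E(1)])
      (simp add: D(2) E(2) algebra_simps)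
qed

lemma holomorphic_fun_on_divide:
  assumes "holomorphic_fun_on f S" "holomorphic_fun_on g S" "\<And>z. z \<in> S \<Longrightarrow> g z \<noteq> 0"
  shows "holomorphic_fun_on (\<lambda>z. f z / g z) S"
  unfolding holomorphic_fun_on_def
proof
  fix z assume z: "z \<in> S"
  then obtain D E where D: "(f has_derivative D) (at z)" "\<forall>c v. D (c *s v) = c * D v"
    and E: "(g has_derivative E) (at z)" "\<forall>c v. E (c *s v) = c * E v"
    using assms unfolding holomorphic_fun_on_def by meson
  show "\<exists>D. ((\<lambda>z. f z / g z) has_derivative D) (at z) \<and> (\<forall>c v. D (c *s v) = c * D v)"
    by (rule exI, rule conjI, rule has_derivative_divide'[OF D(1) E(1) assms(3)[OF z]])
      (simp add: D(2) E(2) algebra_simps)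
qed

lemmas holomorphic_fun_intros = holomorphic_fun_on_const holomorphic_fun_on_component
  holomorphic_fun_on_diff holomorphic_fun_on_mult holomorphic_fun_on_divide

text \<open>By the identity in the hypothesis, \<open>f\<close> maps the closed ball into the closed ball, and a point
  of the closed ball goes to the sphere exactly if it lies on the sphere. A continuous map between compact spaces is proper, and
  properness survives restriction to the preimage of the open ball.\<close>

lemma proper_holomorphic_ball_mapI:
  fixes f :: "complex ^ 'n::finite \<Rightarrow> complex ^ 'm::finite"
  assumes hol: "holomorphic_map_on f UNIV"
    and K: "\<And>z. K z > 0" "\<And>z. 1 - (norm (f z))\<^sup>2 = (1 - (norm z)\<^sup>2) * K z"
  shows "proper_holomorphic_ball_map f"
proof -
  have cont: "continuous_on UNIV f"
    using hol unfolding holomorphic_map_on_def continuous_on_eq_continuous_at[OF open_UNIV]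
    by (metis has_derivative_continuous)
  have lt: "norm (f z) < 1 \<longleftrightarrow> norm z < 1" for z
  proof -
    have "norm (f z) < 1 \<longleftrightarrow> 0 < 1 - (norm (f z))\<^sup>2" by (simp add: abs_square_less_1)
    also have "\<dots> \<longleftrightarrow> 0 < 1 - (norm z)\<^sup>2" unfolding K(2) using K(1)[of z] by (simp add: zero_less_mult_iff)
    also have "\<dots> \<longleftrightarrow> norm z < 1" by (simp add: abs_square_less_1)
    finally show ?thesis .
  qed
  have le: "norm (f z) \<le> 1" if "norm z \<le> 1" for z
  proof -
    have "0 \<le> 1 - (norm (f z))\<^sup>2"
      unfolding K(2) using K(1)[of z] that by (simp add: abs_square_le_1)
    then show ?thesis by (simp add: abs_square_le_1)
  qed
  let ?C = "cball 0 1 :: (complex ^ 'n) set" and ?D = "cball 0 1 :: (complex ^ 'm) set"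
  have "proper_map (top_of_set ?C) (top_of_set ?D) f"
  proof (rule continuous_imp_proper_map)
    show "compact_space (top_of_set ?C)" by (simp add: compact_space_subtopology)
    show "kc_space (top_of_set ?D)"
      by (simp add: Hausdorff_imp_kc_space Hausdorff_space_subtopology)
    show "continuous_map (top_of_set ?C) (top_of_set ?D) f"
      using cont le by (auto intro: continuous_on_subset)
  qed
  then have "proper_map (subtopology (top_of_set ?C) unit_ball) (subtopology (top_of_set ?D) unit_ball) f"
    by (rule proper_map_restriction) (auto simp: lt)
  moreover have "subtopology (top_of_set ?C) unit_ball = top_of_set unit_ball"
    "subtopology (top_of_set ?D) unit_ball = top_of_set unit_ball"
    unfolding subtopology_subtopology by (simp_all add: inf.absorb2 ball_subset_cball)
  moreover have "holomorphic_map_on f unit_ball"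
    using hol by (simp add: holomorphic_map_on_def)
  ultimately show ?thesis
    by (auto simp: proper_holomorphic_ball_map_def lt)
qed

section \<open>Involutions exchanging the origin and a point\<close>

text \<open>For \<open>0 \<le> r < 1\<close> this is the involutive automorphism of the ball that exchanges \<open>0\<close> and the
  point \<open>r\<close> on the \<open>i\<close>-th coordinate axis.\<close>

definition ball_involution :: "real \<Rightarrow> 'n \<Rightarrow> complex ^ 'n::finite \<Rightarrow> complex ^ 'n"
  where "ball_involution r i z =
    (\<chi> j. (if j = i then of_real r - z $ i else of_real (sqrt (1 - r\<^sup>2)) * z $ j) /
      (1 - of_real r * z $ i))"

lemma ball_involution_denominator:
  assumes "0 \<le> r" "r < 1" "z \<in> unit_ball"
  shows "complex_of_real r * z $ i \<noteq> 1"
proof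
  assume "complex_of_real r * z $ i = 1"
  then have "cmod (of_real r * z $ i) = 1" by simp
  then have "1 = r * cmod (z $ i)" using assms(1) by (simp add: norm_mult)
  also have "\<dots> \<le> r * 1"
    using assms Finite_Cartesian_Product.norm_nth_le[of z i] by (intro mult_left_mono) auto
  finally show False using assms(2) by simp
qed

lemma ball_involution_norm:
  assumes r: "0 \<le> r" "r < 1" and z: "z \<in> unit_ball"
  shows "(1 - (norm (ball_involution r i z))\<^sup>2) * (cmod (1 - of_real r * z $ i))\<^sup>2
    = (1 - r\<^sup>2) * (1 - (norm z)\<^sup>2)"
proof -
  let ?d = "1 - complex_of_real r * z $ i" and ?T = "\<Sum>j\<in>UNIV - {i}. (cmod (z $ j))\<^sup>2"
  have d: "?d \<noteq> 0" using ball_involution_denominator[OF assms] by simp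
  have s: "(sqrt (1 - r\<^sup>2))\<^sup>2 = 1 - r\<^sup>2" using r by (simp add: abs_square_le_1)
  have "(norm (ball_involution r i z))\<^sup>2 =
      (cmod (of_real r - z $ i))\<^sup>2 / (cmod ?d)\<^sup>2 +
      (\<Sum>j\<in>UNIV - {i}. (1 - r\<^sup>2) / (cmod ?d)\<^sup>2 * (cmod (z $ j))\<^sup>2)"
    unfolding norm_power2_eq_sum sum.remove[OF finite UNIV_I[of i]]
    by (intro arg_cong2[where f = "(+)"] sum.cong)
      (auto simp: ball_involution_def norm_divide norm_mult power_divide power_mult_distrib s
        simp del: power2_abs real_sqrt_abs)
  then have "(norm (ball_involution r i z))\<^sup>2 * (cmod ?d)\<^sup>2 = (cmod (of_real r - z $ i))\<^sup>2 + (1 - r\<^sup>2) * ?T"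
    unfolding sum_distrib_left[symmetric] using d by (simp add: field_simps)
  moreover have "(cmod ?d)\<^sup>2 - (cmod (of_real r - z $ i))\<^sup>2 = (1 - r\<^sup>2) * (1 - (cmod (z $ i))\<^sup>2)"
    unfolding cmod_power2 by (simp add: power2_eq_square algebra_simps)
  moreover have "(norm z)\<^sup>2 = (cmod (z $ i))\<^sup>2 + ?T"
    unfolding norm_power2_eq_sum by (rule sum.remove) auto
  ultimately show ?thesis by (simp add: algebra_simps)
qed

lemma ball_involution_mem:
  assumes r: "0 \<le> r" "r < 1" and z: "z \<in> unit_ball"
  shows "ball_involution r i z \<in> unit_ball"
proof -
  have "0 < (1 - r\<^sup>2) * (1 - (norm z)\<^sup>2)"
    using r z by (intro mult_pos_pos) (simp_all add: abs_square_less_1)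
  then have "0 < 1 - (norm (ball_involution r i z))\<^sup>2"
    unfolding ball_involution_norm[OF assms, of i, symmetric]
    by (rule zero_less_mult_pos2) (simp add: ball_involution_denominator[OF assms])
  then show ?thesis by (simp add: abs_square_less_1)
qed

lemma ball_involution_involutive:
  assumes r: "0 \<le> r" "r < 1" and z: "z \<in> unit_ball"
  shows "ball_involution r i (ball_involution r i z) = z"
proof -
  let ?r = "complex_of_real r" and ?d = "1 - complex_of_real r * z $ i"
  have d: "?d \<noteq> 0" using ball_involution_denominator[OF assms] by simp
  have s: "complex_of_real (sqrt (1 - r\<^sup>2)) * (complex_of_real (sqrt (1 - r\<^sup>2)) * x) = (1 - ?r\<^sup>2) * x" for x
  proof -
    have "sqrt (1 - r\<^sup>2) * sqrt (1 - r\<^sup>2) = 1 - r\<^sup>2" using r by (simp add: abs_square_le_1)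
    then show ?thesis by (metis (no_types) mult.assoc of_real_1 of_real_diff of_real_mult of_real_power)
  qed
  have "1 - r\<^sup>2 \<noteq> 0" using r by (simp add: abs_square_eq_1)
  then have r1: "1 - ?r\<^sup>2 \<noteq> 0" by (metis of_real_1 of_real_diff of_real_eq_0_iff of_real_power)
  have e: "1 - ?r * (?r - z $ i) / ?d = (1 - ?r\<^sup>2) / ?d"
    using d by (simp add: field_simps power2_eq_square)
  have f: "?r - (?r - z $ i) / ?d = (1 - ?r\<^sup>2) * z $ i / ?d"
    using d by (simp add: field_simps power2_eq_square)
  show ?thesis
    using d r1 by (auto simp: vec_eq_iff ball_involution_def e f s)
qed

lemma ball_involution_in_ball_aut:
  assumes "0 \<le> r" "r < 1"
  shows "restrict (ball_involution r i) unit_ball \<in> carrier ball_aut"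
proof -
  have "holomorphic_map_on (ball_involution r i) unit_ball"
  proof (rule holomorphic_map_on_components)
    fix j
    show "holomorphic_fun_on (\<lambda>z. ball_involution r i z $ j) unit_ball"
      by (cases "j = i") (auto simp: ball_involution_def ball_involution_denominator[OF assms]
        intro!: holomorphic_fun_intros)
  qed
  then show ?thesis
    by (intro restrict_in_ball_aut[where g = "ball_involution r i"])
      (simp_all only: ball_involution_mem[OF assms] ball_involution_involutive[OF assms])
qed

lemma ball_involution_swaps: "ball_involution r i (\<chi> j. if j = i then of_real r else 0) = 0"
  by (simp add: vec_eq_iff ball_involution_def)

section \<open>The four maps are proper\<close>

lemma vec2_eq_iff: "(z :: complex ^ 2) = w \<longleftrightarrow> z $ 1 = w $ 1 \<and> z $ 2 = w $ 2"
  by (simp add: vec_eq_iff forall_2)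

lemma vec3_eq_iff: "(z :: complex ^ 3) = w \<longleftrightarrow> z $ 1 = w $ 1 \<and> z $ 2 = w $ 2 \<and> z $ 3 = w $ 3"
  by (simp add: vec_eq_iff forall_3)

lemma norm_vec2: "(norm (z :: complex ^ 2))\<^sup>2 = (cmod (z $ 1))\<^sup>2 + (cmod (z $ 2))\<^sup>2"
  by (simp add: norm_power2_eq_sum sum_2)

lemma norm_vec3: "(norm (z :: complex ^ 3))\<^sup>2 = (cmod (z $ 1))\<^sup>2 + (cmod (z $ 2))\<^sup>2 + (cmod (z $ 3))\<^sup>2"
  by (simp add: norm_power2_eq_sum sum_3)

lemma map_a_nth [simp]: "map_a z $ 1 = z $ 1" "map_a z $ 2 = z $ 2" "map_a z $ 3 = 0"
  by (simp_all add: map_a_def)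

lemma map_b_nth [simp]: "map_b z $ 1 = z $ 1" "map_b z $ 2 = z $ 1 * z $ 2" "map_b z $ 3 = (z $ 2)\<^sup>2"
  by (simp_all add: map_b_def)

lemma map_c_nth [simp]:
  "map_c z $ 1 = (z $ 1)\<^sup>2" "map_c z $ 2 = complex_of_real (sqrt 2) * z $ 1 * z $ 2" "map_c z $ 3 = (z $ 2)\<^sup>2"
  by (simp_all add: map_c_def)

lemma map_d_nth [simp]:
  "map_d z $ 1 = z $ 1 ^ 3" "map_d z $ 2 = complex_of_real (sqrt 3) * z $ 1 * z $ 2" "map_d z $ 3 = z $ 2 ^ 3"
  by (simp_all add: map_d_def)

lemma holomorphic_maps:
  "holomorphic_map_on map_a UNIV" "holomorphic_map_on map_b UNIV"
  "holomorphic_map_on map_c UNIV" "holomorphic_map_on map_d UNIV"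
proof -
  have forall: "\<forall>i. P i" if "P 1" "P 2" "P 3" for P :: "3 \<Rightarrow> bool"
    using that by (simp add: forall_3)
  show "holomorphic_map_on map_a UNIV" "holomorphic_map_on map_b UNIV"
    "holomorphic_map_on map_c UNIV" "holomorphic_map_on map_d UNIV"
    by (rule holomorphic_map_on_components, rule spec[OF forall];
        simp add: power2_eq_square power3_eq_cube; intro holomorphic_fun_intros)+
qed

text \<open>In terms of \<open>x = |z\<^sub>1|\<^sup>2\<close> and \<open>y = |z\<^sub>2|\<^sup>2\<close>, the polynomial \<open>1 - |f(z)|\<^sup>2\<close> is divisible by
  \<open>1 - x - y\<close>, and the quotient has positive values. For the last map this is the factorization
  of \<open>u\<^sup>3 + v\<^sup>3 + w\<^sup>3 - 3uvw\<close> at \<open>(1, -x, -y)\<close>.\<close>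

lemma proper_maps:
  "proper_holomorphic_ball_map map_a" "proper_holomorphic_ball_map map_b"
  "proper_holomorphic_ball_map map_c" "proper_holomorphic_ball_map map_d"
proof -
  show "proper_holomorphic_ball_map map_a"
    by (rule proper_holomorphic_ball_mapI[where K = "\<lambda>z. 1"])
      (simp_all add: holomorphic_maps norm_vec2 norm_vec3)
  show "proper_holomorphic_ball_map map_b"
  proof (rule proper_holomorphic_ball_mapI[where K = "\<lambda>z. 1 + (cmod (z $ 2))\<^sup>2"])
    fix z :: "complex ^ 2"
    show "0 < 1 + (cmod (z $ 2))\<^sup>2" by (simp add: add_pos_nonneg)
    show "1 - (norm (map_b z))\<^sup>2 = (1 - (norm z)\<^sup>2) * (1 + (cmod (z $ 2))\<^sup>2)"
      by (simp add: norm_vec2 norm_vec3 norm_mult norm_power) algebra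
  qed (rule holomorphic_maps)
  show "proper_holomorphic_ball_map map_c"
  proof (rule proper_holomorphic_ball_mapI[where K = "\<lambda>z. 1 + (norm z)\<^sup>2"])
    fix z :: "complex ^ 2"
    show "0 < 1 + (norm z)\<^sup>2" by (simp add: add_pos_nonneg)
    show "1 - (norm (map_c z))\<^sup>2 = (1 - (norm z)\<^sup>2) * (1 + (norm z)\<^sup>2)"
      by (simp add: norm_vec2 norm_vec3 norm_mult norm_power power_mult_distrib) algebra
  qed (rule holomorphic_maps)
  show "proper_holomorphic_ball_map map_d"
  proof (rule proper_holomorphic_ball_mapI[where K = "\<lambda>z. 1 + (cmod (z $ 1))\<^sup>2 + (cmod (z $ 2))\<^sup>2 +
      (((cmod (z $ 1))\<^sup>2 - (cmod (z $ 2))\<^sup>2)\<^sup>2 + (cmod (z $ 1))\<^sup>2 * (cmod (z $ 2))\<^sup>2)"])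
    fix z :: "complex ^ 2"
    show "0 < 1 + (cmod (z $ 1))\<^sup>2 + (cmod (z $ 2))\<^sup>2 +
      (((cmod (z $ 1))\<^sup>2 - (cmod (z $ 2))\<^sup>2)\<^sup>2 + (cmod (z $ 1))\<^sup>2 * (cmod (z $ 2))\<^sup>2)"
      by (simp add: add_pos_nonneg)
    show "1 - (norm (map_d z))\<^sup>2 = (1 - (norm z)\<^sup>2) * (1 + (cmod (z $ 1))\<^sup>2 + (cmod (z $ 2))\<^sup>2 +
      (((cmod (z $ 1))\<^sup>2 - (cmod (z $ 2))\<^sup>2)\<^sup>2 + (cmod (z $ 1))\<^sup>2 * (cmod (z $ 2))\<^sup>2))"
      by (simp add: norm_vec2 norm_vec3 norm_mult norm_power power_mult_distrib) algebra
  qed (rule holomorphic_maps)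
qed

lemma maps_into_ball:
  "map_a ` unit_ball \<subseteq> unit_ball" "map_b ` unit_ball \<subseteq> unit_ball"
  "map_c ` unit_ball \<subseteq> unit_ball" "map_d ` unit_ball \<subseteq> unit_ball"
  using proper_maps by (simp_all only: proper_holomorphic_ball_map_def)

section \<open>Two by two matrices\<close>

lemma matrix2_nth [simp]:
  "matrix2 a b c d $ 1 $ 1 = a" "matrix2 a b c d $ 1 $ 2 = b"
  "matrix2 a b c d $ 2 $ 1 = c" "matrix2 a b c d $ 2 $ 2 = d"
  by (simp_all add: matrix2_def)

lemma matrix2_surj: "A = matrix2 (A $ 1 $ 1) (A $ 1 $ 2) (A $ 2 $ 1) (A $ 2 $ 2)"
  by (simp add: vec_eq_iff forall_2)

lemma matrix2_eq_iff:
  "matrix2 a b c d = matrix2 a' b' c' d' \<longleftrightarrow> a = a' \<and> b = b' \<and> c = c' \<and> d = d'"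
  by (metis matrix2_nth)

lemma matrix2_vector [simp]:
  "(matrix2 a b c d *v z) $ 1 = a * z $ 1 + b * z $ 2"
  "(matrix2 a b c d *v z) $ 2 = c * z $ 1 + d * z $ 2"
  by (simp_all add: matrix_vector_mult_def sum_2)

lemma matrix2_mult:
  "matrix2 a b c d ** matrix2 a' b' c' d' =
    matrix2 (a * a' + b * c') (a * b' + b * d') (c * a' + d * c') (c * b' + d * d')"
  by (simp add: vec_eq_iff forall_2 matrix_matrix_mult_def sum_2)

lemma matrix2_one: "mat 1 = matrix2 1 0 0 1"
  by (simp add: vec_eq_iff forall_2 mat_def)

lemma conj_transpose_matrix2:
  "conj_transpose (matrix2 a b c d) = matrix2 (cnj a) (cnj c) (cnj b) (cnj d)"
  by (simp add: vec_eq_iff forall_2 conj_transpose_def)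

lemma unitary_matrix2_iff:
  "unitary_matrix (matrix2 a b c d) \<longleftrightarrow>
    cnj a * a + cnj c * c = 1 \<and> cnj a * b + cnj c * d = 0 \<and>
    cnj b * a + cnj d * c = 0 \<and> cnj b * b + cnj d * d = 1"
proof -
  have "unitary_matrix (matrix2 a b c d) \<longleftrightarrow> conj_transpose (matrix2 a b c d) ** matrix2 a b c d = mat 1"
    using unitary_matrixI unitary_matrix_def by blast
  then show ?thesis
    by (simp add: conj_transpose_matrix2 matrix2_mult matrix2_one matrix2_eq_iff)
qed

lemma cnj_mult_eq_1_iff: "cnj a * a = 1 \<longleftrightarrow> cmod a = 1"
proof -
  have "cnj a * a = of_real ((cmod a)\<^sup>2)" by (simp only: complex_norm_square mult.commute)
  then show ?thesis by (simp only: of_real_eq_1_iff) (simp add: abs_square_eq_1)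
qed

lemma unitary_diagonal_iff: "unitary_matrix (matrix2 a 0 0 d) \<longleftrightarrow> cmod a = 1 \<and> cmod d = 1"
  by (simp add: unitary_matrix2_iff cnj_mult_eq_1_iff)

lemma unitary_antidiagonal_iff: "unitary_matrix (matrix2 0 b c 0) \<longleftrightarrow> cmod b = 1 \<and> cmod c = 1"
  by (auto simp add: unitary_matrix2_iff cnj_mult_eq_1_iff)

lemma unitary_matrix2_cases:
  assumes "unitary_matrix (matrix2 a b c d)" "a * b = 0"
  shows "b = 0 \<and> c = 0 \<or> a = 0 \<and> d = 0"
  using assms by (auto simp: unitary_matrix2_iff)

lemma unitary_groupE:
  assumes "\<gamma> \<in> (unitary_group :: (complex ^ 2 \<Rightarrow> complex ^ 2) set)"
  obtains a b c d where "unitary_matrix (matrix2 a b c d)" "\<gamma> = matrix_aut (matrix2 a b c d)"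
  using assms unfolding unitary_group_def by (metis imageE matrix2_surj mem_Collect_eq)

lemma diagonal_unitary_group_eq:
  "diagonal_unitary_group = {matrix_aut (matrix2 a 0 0 d) | a d. cmod a = 1 \<and> cmod d = 1}"
proof -
  have "{A :: complex ^ 2 ^ 2. unitary_matrix A \<and> (\<forall>i j. i \<noteq> j \<longrightarrow> A $ i $ j = 0)}
      = {matrix2 a 0 0 d | a d. cmod a = 1 \<and> cmod d = 1}" (is "?L = ?R")
  proof
    show "?L \<subseteq> ?R"
    proof
      fix A :: "complex ^ 2 ^ 2" assume A: "A \<in> ?L"
      then have "A = matrix2 (A $ 1 $ 1) 0 0 (A $ 2 $ 2)"
        using matrix2_surj[of A] by (auto simp: forall_2)
      then show "A \<in> ?R" using A unitary_diagonal_iff by (metis (mono_tags, lifting) mem_Collect_eq)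
    qed
    show "?R \<subseteq> ?L" by (auto simp: unitary_diagonal_iff forall_2)
  qed
  then show ?thesis unfolding diagonal_unitary_group_def by auto
qed

section \<open>The linear embedding\<close>

text \<open>A unitary matrix moves \<open>\<gamma> 0\<close> to a point \<open>(r, 0)\<close>, an involution moves that point to the
  origin, and the composition with \<open>\<gamma>\<close> is unitary by Cartan's theorem.\<close>

lemma ball_aut_generated:
  fixes H :: "(complex ^ 2 \<Rightarrow> complex ^ 2) set"
  assumes H: "subgroup H ball_aut" and U: "unitary_group \<subseteq> H"
    and I: "\<And>r. 0 \<le> r \<Longrightarrow> r < 1 \<Longrightarrow> restrict (ball_involution r 1) unit_ball \<in> H"
  shows "H = carrier ball_aut"
proof
  interpret group "ball_aut :: (complex ^ 2 \<Rightarrow> complex ^ 2) monoid" by (rule group_ball_aut)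
  show "H \<subseteq> carrier ball_aut" using H by (rule subgroup.subset)
  show "carrier ball_aut \<subseteq> H"
  proof
    fix \<gamma> :: "complex ^ 2 \<Rightarrow> complex ^ 2" assume \<gamma>: "\<gamma> \<in> carrier ball_aut"
    define p where "p = \<gamma> 0"
    define r where "r = norm p"
    have p: "p \<in> unit_ball" unfolding p_def using ball_aut_mem[OF \<gamma>, of 0] by simp
    have r: "0 \<le> r" "r < 1" using p by (simp_all add: r_def)
    obtain U where U': "unitary_matrix U" and Up: "U *v p = (\<chi> j. if j = 1 then of_real r else 0)"
    proof (cases "p = 0")
      case True
      then show ?thesis using that[of "mat 1"] by (simp add: r_def unitary_matrix_one vec_eq_iff)
    next
      case False
      then have r0: "complex_of_real r \<noteq> 0" by (simp add: r_def)
      have r2: "(complex_of_real r)\<^sup>2 = p $ 1 * cnj (p $ 1) + p $ 2 * cnj (p $ 2)"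
        by (simp only: r_def norm_vec2 of_real_add complex_norm_square flip: of_real_power)
      \<comment> \<open>The rows of \<open>?U\<close> pair with \<open>p\<close> and with a vector orthogonal to it, both normalized.\<close>
      let ?U = "matrix2 (cnj (p $ 1) / r) (cnj (p $ 2) / r) (- p $ 2 / r) (p $ 1 / r)"
      have "unitary_matrix ?U"
        using r0 by (simp add: r2[symmetric, unfolded power2_eq_square] unitary_matrix2_iff field_simps power2_eq_square)
      moreover have "?U *v p = (\<chi> j. if j = 1 then of_real r else 0)"
        using r0 by (simp add: r2[symmetric, unfolded power2_eq_square] vec2_eq_iff field_simps power2_eq_square)
      ultimately show ?thesis by (rule that)
    qed
    let ?\<phi> = "restrict (ball_involution r 1) unit_ball :: complex ^ 2 \<Rightarrow> complex ^ 2"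
    have \<phi>: "?\<phi> \<in> H" and \<phi>c: "?\<phi> \<in> carrier ball_aut"
      using I[OF r] ball_involution_in_ball_aut[OF r] by auto
    have u: "matrix_aut U \<in> H" and uc: "matrix_aut U \<in> carrier ball_aut"
      using U U' matrix_aut_in_ball_aut by (auto simp: unitary_group_def)
    let ?m = "?\<phi> \<otimes>\<^bsub>ball_aut\<^esub> matrix_aut U"
    have m: "?m \<in> H" and mc: "?m \<in> carrier ball_aut"
      using \<phi> u \<phi>c uc H by (auto intro: subgroup.m_closed)
    let ?\<delta> = "?m \<otimes>\<^bsub>ball_aut\<^esub> \<gamma>"
    have \<delta>c: "?\<delta> \<in> carrier ball_aut" using mc \<gamma> by simp
    have "?\<delta> 0 = ?m p"
      unfolding mult_ball_aut[OF mc \<gamma>] by (simp add: p_def)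
    also have "\<dots> = ?\<phi> (matrix_aut U p)"
      unfolding mult_ball_aut[OF \<phi>c uc] using p by simp
    also have "\<dots> = 0"
      using p Up unitary_matrix_norm[OF U', of p] by (simp add: matrix_aut_def ball_involution_swaps)
    finally have "?\<delta> 0 = 0" .
    then have "?\<delta> \<in> H"
      using ball_aut_fixing_zero_unitary[OF \<delta>c] U by (auto simp: unitary_group_def)
    moreover have "\<gamma> = inv\<^bsub>ball_aut\<^esub> ?m \<otimes>\<^bsub>ball_aut\<^esub> ?\<delta>"
      using mc \<gamma> inv_solve_left by blast
    ultimately show "\<gamma> \<in> H"
      using m H by (metis subgroup.m_closed subgroup.m_inv_closed)
  qed
qed

lemma invariant_group_a: "invariant_group map_a = {\<one>\<^bsub>ball_aut\<^esub>}"
proof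
  show "{\<one>\<^bsub>ball_aut\<^esub>} \<subseteq> invariant_group map_a"
    using subgroup.one_closed[OF subgroup_invariant_group] by blast
  show "invariant_group map_a \<subseteq> {\<one>\<^bsub>ball_aut\<^esub>}"
  proof
    fix \<gamma> assume "\<gamma> \<in> invariant_group map_a"
    then have \<gamma>: "\<gamma> \<in> carrier ball_aut" and "\<And>z. z \<in> unit_ball \<Longrightarrow> \<gamma> z = z"
      by (auto simp: invariant_group_def vec3_eq_iff vec2_eq_iff)
    then have "restrict \<gamma> unit_ball = \<one>\<^bsub>ball_aut\<^esub>" unfolding one_ball_aut by (metis restrict_ext)
    then show "\<gamma> \<in> {\<one>\<^bsub>ball_aut\<^esub>}" using ball_aut_ext[OF \<gamma>] by simp
  qed
qed

lemma hermitian_invariant_group_a: "hermitian_invariant_group map_a = carrier ball_aut"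
proof (rule ball_aut_generated[OF subgroup_hermitian_invariant_group[OF maps_into_ball(1)]])
  show "unitary_group \<subseteq> hermitian_invariant_group map_a"
  proof
    fix \<gamma> :: "complex ^ 2 \<Rightarrow> complex ^ 2" assume "\<gamma> \<in> unitary_group"
    then obtain a b c d where A: "unitary_matrix (matrix2 a b c d)" and \<gamma>: "\<gamma> = matrix_aut (matrix2 a b c d)"
      by (rule unitary_groupE)
    let ?M = "vector [vector [a, b, 0], vector [c, d, 0], vector [0, 0, 1]] :: complex ^ 3 ^ 3"
    have "unitary_matrix ?M"
      using A unfolding unitary_matrix2_iff
      by (intro unitary_matrixI)
        (simp add: vec_eq_iff forall_3 matrix_matrix_mult_def sum_3 conj_transpose_def mat_def)
    then show "\<gamma> \<in> hermitian_invariant_group map_a"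
      unfolding \<gamma> by (rule matrix_aut_in_hermitian_invariant_group[OF A _ maps_into_ball(1)])
        (simp add: vec3_eq_iff matrix_vector_mult_def sum_3 sum_2)
  qed
  fix r :: real assume r: "0 \<le> r" "r < 1"
  have "map_a (ball_involution r 1 z) = ball_involution r 1 (map_a z)" for z
    by (simp add: vec3_eq_iff ball_involution_def)
  then show "restrict (ball_involution r 1) unit_ball \<in> hermitian_invariant_group map_a"
    using maps_into_ball(1) ball_involution_in_ball_aut[OF r, of "1 :: 2"]
    unfolding hermitian_invariant_group_def
    by (auto intro!: bexI[OF _ ball_involution_in_ball_aut[OF r, of 1]] simp del: mem_ball)
qed

text \<open>Polynomial identities in the entries of a matrix are obtained by evaluation at these
  vectors.\<close>

lemma test_vectors_in_ball:
  "vector [1/2, 0] \<in> (unit_ball :: (complex ^ 2) set)"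
  "vector [0, 1/2] \<in> (unit_ball :: (complex ^ 2) set)"
  "vector [1/2, 1/2] \<in> (unit_ball :: (complex ^ 2) set)"
  "vector [1/2, -1/2] \<in> (unit_ball :: (complex ^ 2) set)"
proof -
  have "norm z < 1" if "(cmod (z $ 1))\<^sup>2 + (cmod (z $ 2))\<^sup>2 < 1" for z :: "complex ^ 2"
    using that abs_square_less_1[of "norm z"] by (simp add: norm_vec2)
  then show "vector [1/2, 0] \<in> (unit_ball :: (complex ^ 2) set)"
    "vector [0, 1/2] \<in> (unit_ball :: (complex ^ 2) set)"
    "vector [1/2, 1/2] \<in> (unit_ball :: (complex ^ 2) set)"
    "vector [1/2, -1/2] \<in> (unit_ball :: (complex ^ 2) set)"
    by (simp_all add: norm_divide power_divide)
qed

section \<open>The Whitney map\<close>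

lemma map_b_eq_iff:
  "map_b z = map_b w \<longleftrightarrow> z $ 1 = w $ 1 \<and> (z $ 2 = w $ 2 \<or> z $ 1 = 0 \<and> z $ 2 = - w $ 2)"
  by (auto simp: vec3_eq_iff power2_eq_iff)

text \<open>The fibres of the Whitney map with two points fill the punctured disc \<open>z\<^sub>1 = 0\<close>, \<open>z\<^sub>2 \<noteq> 0\<close>,
  so \<open>\<gamma>\<close> maps the punctured disc into itself. The centre of the disc is a limit of such points.\<close>

lemma hermitian_invariant_group_b_axis:
  assumes \<gamma>: "\<gamma> \<in> hermitian_invariant_group map_b" and z: "z \<in> unit_ball" "z $ 1 = 0"
  shows "\<gamma> z $ 1 = 0"
proof -
  have \<gamma>c: "\<gamma> \<in> carrier ball_aut" using \<gamma> by (simp add: hermitian_invariant_group_def)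
  have punctured: "\<gamma> y $ 1 = 0" if y: "y \<in> unit_ball" "y $ 1 = 0" "y $ 2 \<noteq> 0" for y
  proof -
    have "- y \<in> unit_ball" "map_b (- y) = map_b y" "- y \<noteq> y"
      using y by (auto simp: map_b_eq_iff vec2_eq_iff)
    then have "map_b (\<gamma> (- y)) = map_b (\<gamma> y)" "\<gamma> (- y) \<noteq> \<gamma> y"
      using hermitian_invariant_fibres[OF \<gamma> maps_into_ball(2)] ball_aut_inj[OF \<gamma>c] y(1) by blast+
    then show ?thesis by (auto simp: map_b_eq_iff vec2_eq_iff)
  qed
  show ?thesis
  proof (cases "z $ 2 = 0")
    case True
    then have "z = 0" using z by (simp add: vec2_eq_iff)
    let ?e = "vector [0, 1/2] :: complex ^ 2"
    have "isCont \<gamma> 0"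
      using ball_aut_holomorphic[OF \<gamma>c] has_derivative_continuous
      unfolding holomorphic_map_on_def by force
    moreover have "((\<lambda>t::real. t *\<^sub>R ?e) \<longlongrightarrow> 0 *\<^sub>R ?e) (at 0)"
      by (intro tendsto_intros)
    ultimately have "((\<lambda>t::real. \<gamma> (t *\<^sub>R ?e)) \<longlongrightarrow> \<gamma> 0) (at 0)"
      using isCont_tendsto_compose[of 0 \<gamma>] by simp
    then have "((\<lambda>t::real. \<gamma> (t *\<^sub>R ?e) $ 1) \<longlongrightarrow> \<gamma> 0 $ 1) (at 0)"
      by (rule tendsto_vec_nth)
    moreover have "eventually (\<lambda>t::real. \<gamma> (t *\<^sub>R ?e) $ 1 = 0) (at 0)"
      unfolding eventually_at
    proof (intro exI[of _ 1] conjI ballI impI)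
      fix t :: real assume t: "t \<noteq> 0 \<and> dist t 0 < 1"
      have "\<bar>t\<bar> * norm ?e < 1"
        using t test_vectors_in_ball(2) mult_mono[of "\<bar>t\<bar>" 1 "norm ?e" "norm ?e"] by simp
      then show "\<gamma> (t *\<^sub>R ?e) $ 1 = 0"
        using t by (intro punctured) simp_all
    qed simp
    ultimately have "((\<lambda>t::real. 0) \<longlongrightarrow> \<gamma> 0 $ 1) (at (0::real))"
      by (rule Lim_transform_eventually)
    then show ?thesis
      using tendsto_unique[OF _ _ tendsto_const] \<open>z = 0\<close> by (metis trivial_limit_at)
  qed (use punctured z in blast)
qed

lemma hermitian_invariant_group_b_subset:
  "hermitian_invariant_group map_b \<subseteq> diagonal_unitary_group"
proof
  fix \<gamma> assume \<gamma>: "\<gamma> \<in> hermitian_invariant_group map_b"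
  have \<gamma>c: "\<gamma> \<in> carrier ball_aut" using \<gamma> by (simp add: hermitian_invariant_group_def)
  have p: "\<gamma> 0 \<in> unit_ball" using ball_aut_mem[OF \<gamma>c, of 0] by simp
  have p1: "\<gamma> 0 $ 1 = 0" by (rule hermitian_invariant_group_b_axis[OF \<gamma>]) simp_all
  \<comment> \<open>The point \<open>-\<gamma> 0\<close> lies in the same fibre, and this fibre is a singleton because that of
    \<open>0\<close> is.\<close>
  have "- \<gamma> 0 = \<gamma> 0"
    by (rule hermitian_invariant_singleton_fibre[OF \<gamma> maps_into_ball(2)])
      (use p p1 in \<open>auto simp: map_b_eq_iff vec2_eq_iff\<close>)
  then have "\<gamma> 0 = 0" by (simp add: vec2_eq_iff)
  then have "\<gamma> \<in> unitary_group"
    using ball_aut_fixing_zero_unitary[OF \<gamma>c] by (metis imageI mem_Collect_eq unitary_group_def)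
  then obtain a b c d where A: "unitary_matrix (matrix2 a b c d)" and eq: "\<gamma> = matrix_aut (matrix2 a b c d)"
    by (rule unitary_groupE)
  have "b = 0"
    using hermitian_invariant_group_b_axis[OF \<gamma> test_vectors_in_ball(2)] test_vectors_in_ball(2)
    by (simp add: eq matrix_aut_def)
  then have "c = 0" using A unitary_matrix2_cases[OF A] by (auto simp: unitary_matrix2_iff)
  then show "\<gamma> \<in> diagonal_unitary_group"
    using A \<open>b = 0\<close> by (auto simp: eq diagonal_unitary_group_eq unitary_diagonal_iff)
qed

lemma unitary_diagonal3:
  assumes "cmod p = 1" "cmod q = 1" "cmod s = 1"
  shows "unitary_matrix (vector [vector [p, 0, 0], vector [0, q, 0], vector [0, 0, s]] :: complex ^ 3 ^ 3)"
  by (rule unitary_matrixI)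
    (use assms in \<open>simp add: vec_eq_iff forall_3 matrix_matrix_mult_def sum_3 conj_transpose_def
      mat_def cnj_mult_eq_1_iff\<close>)

lemma hermitian_invariant_group_b: "hermitian_invariant_group map_b = diagonal_unitary_group"
proof
  show "diagonal_unitary_group \<subseteq> hermitian_invariant_group map_b"
  proof
    fix \<gamma> assume "\<gamma> \<in> diagonal_unitary_group"
    then obtain a d where ad: "cmod a = 1" "cmod d = 1" and \<gamma>: "\<gamma> = matrix_aut (matrix2 a 0 0 d)"
      by (auto simp: diagonal_unitary_group_eq)
    have "unitary_matrix (matrix2 a 0 0 d)" using ad by (simp add: unitary_diagonal_iff)
    moreover have "unitary_matrix (vector [vector [a, 0, 0], vector [0, a * d, 0], vector [0, 0, d\<^sup>2]] :: complex ^ 3 ^ 3)"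
      by (rule unitary_diagonal3) (simp_all add: ad norm_mult norm_power)
    ultimately show "\<gamma> \<in> hermitian_invariant_group map_b"
      unfolding \<gamma> by (rule matrix_aut_in_hermitian_invariant_group[OF _ _ maps_into_ball(2)])
        (simp add: vec3_eq_iff matrix_vector_mult_def sum_3 sum_2 power_mult_distrib)
  qed
qed (rule hermitian_invariant_group_b_subset)

lemma invariant_group_b: "invariant_group map_b = {\<one>\<^bsub>ball_aut\<^esub>}"
proof
  show "{\<one>\<^bsub>ball_aut\<^esub>} \<subseteq> invariant_group map_b"
    using subgroup.one_closed[OF subgroup_invariant_group] by blast
  show "invariant_group map_b \<subseteq> {\<one>\<^bsub>ball_aut\<^esub>}"
  proof
    fix \<gamma> assume \<gamma>: "\<gamma> \<in> invariant_group map_b"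
    then have "\<gamma> \<in> diagonal_unitary_group"
      using invariant_group_subset_hermitian[OF maps_into_ball(2)] hermitian_invariant_group_b by blast
    then obtain a d where eq: "\<gamma> = matrix_aut (matrix2 a 0 0 d)"
      by (auto simp: diagonal_unitary_group_eq)
    have "map_b (matrix2 a 0 0 d *v vector [1/2, 1/2]) = map_b (vector [1/2, 1/2])"
      using \<gamma> test_vectors_in_ball(3) by (simp add: invariant_group_def eq matrix_aut_def del: mem_ball)
    then have "a = 1 \<and> d = 1" by (auto simp: vec3_eq_iff)
    then show "\<gamma> \<in> {\<one>\<^bsub>ball_aut\<^esub>}" by (simp add: eq matrix_aut_one flip: matrix2_one)
  qed
qed

section \<open>The homogeneous quadratic map\<close>

lemma map_zero_fibres:
  "map_b z = map_b 0 \<Longrightarrow> z = 0" "map_c z = map_c 0 \<Longrightarrow> z = 0" "map_d z = map_d 0 \<Longrightarrow> z = 0"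
  by (simp_all add: vec3_eq_iff vec2_eq_iff)

text \<open>The action of a matrix on quadratic forms in two variables, in the orthonormal basis
  \<open>x\<^sup>2\<close>, \<open>\<surd>2 x y\<close>, \<open>y\<^sup>2\<close>.\<close>

definition sym_square :: "complex \<Rightarrow> complex \<Rightarrow> complex \<Rightarrow> complex \<Rightarrow> complex ^ 3 ^ 3"
  where "sym_square a b c d =
    (let s = complex_of_real (sqrt 2) in
      vector [vector [a\<^sup>2, s * a * b, b\<^sup>2],
              vector [s * a * c, a * d + b * c, s * b * d],
              vector [c\<^sup>2, s * c * d, d\<^sup>2]])"

lemma sqrt2_square: "complex_of_real (sqrt 2) * complex_of_real (sqrt 2) = 2"
  by (metis of_real_mult of_real_numeral real_sqrt_mult_self abs_numeral)

lemma map_c_matrix2: "map_c (matrix2 a b c d *v z) = sym_square a b c d *v map_c z"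
proof -
  have s: "complex_of_real (sqrt 2) * (complex_of_real (sqrt 2) * x) = 2 * x" for x
    using sqrt2_square by (metis mult.assoc)
  show ?thesis
    by (simp add: vec3_eq_iff sym_square_def Let_def matrix_vector_mult_def sum_3 sum_2 power2_eq_square
        algebra_simps s sqrt2_square)
qed

lemma sym_square_mult:
  "sym_square a b c d ** sym_square a' b' c' d' =
    sym_square (a * a' + b * c') (a * b' + b * d') (c * a' + d * c') (c * b' + d * d')"
proof -
  have s: "complex_of_real (sqrt 2) * (complex_of_real (sqrt 2) * x) = 2 * x" for x
    using sqrt2_square by (metis mult.assoc)
  show ?thesis
    by (simp add: vec_eq_iff forall_3 sym_square_def Let_def matrix_matrix_mult_def sum_3 power2_eq_square
        algebra_simps s sqrt2_square)
qed

lemma unitary_sym_square: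
  assumes "unitary_matrix (matrix2 a b c d)"
  shows "unitary_matrix (sym_square a b c d)"
proof (rule unitary_matrixI)
  have "conj_transpose (sym_square a b c d) = sym_square (cnj a) (cnj c) (cnj b) (cnj d)"
    by (simp add: vec_eq_iff forall_3 sym_square_def Let_def conj_transpose_def)
  moreover have "sym_square 1 0 0 1 = mat 1"
    by (simp add: vec_eq_iff forall_3 sym_square_def Let_def mat_def)
  ultimately show "conj_transpose (sym_square a b c d) ** sym_square a b c d = mat 1"
    using assms by (simp add: sym_square_mult unitary_matrix2_iff)
qed

lemma hermitian_invariant_group_c: "hermitian_invariant_group map_c = unitary_group"
proof
  show "hermitian_invariant_group map_c \<subseteq> unitary_group"
    by (rule hermitian_invariant_group_subset_unitary[OF maps_into_ball(3), where \<sigma> = uminus])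
      (simp_all add: map_zero_fibres vec3_eq_iff vec2_eq_iff)
  show "unitary_group \<subseteq> hermitian_invariant_group map_c"
  proof
    fix \<gamma> :: "complex ^ 2 \<Rightarrow> complex ^ 2" assume "\<gamma> \<in> unitary_group"
    then obtain a b c d where A: "unitary_matrix (matrix2 a b c d)" and \<gamma>: "\<gamma> = matrix_aut (matrix2 a b c d)"
      by (rule unitary_groupE)
    show "\<gamma> \<in> hermitian_invariant_group map_c"
      unfolding \<gamma> using A unitary_sym_square[OF A] maps_into_ball(3) map_c_matrix2
      by (rule matrix_aut_in_hermitian_invariant_group)
  qed
qed

lemma matrix_aut_in_invariant_group:
  assumes "unitary_matrix A" "\<And>z. f (A *v z) = f z"
  shows "matrix_aut A \<in> invariant_group f"
  using assms matrix_aut_in_ball_aut by (simp add: invariant_group_def) (simp add: matrix_aut_def)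

lemma invariant_group_c:
  "invariant_group map_c = {matrix_aut (matrix2 e 0 0 e) | e. e\<^sup>2 = 1}"
proof
  show "invariant_group map_c \<subseteq> {matrix_aut (matrix2 e 0 0 e) | e. e\<^sup>2 = 1}"
  proof
    fix \<gamma> assume \<gamma>: "\<gamma> \<in> invariant_group map_c"
    then have "\<gamma> \<in> unitary_group"
      using invariant_group_subset_hermitian[OF maps_into_ball(3)] hermitian_invariant_group_c by blast
    then obtain a b c d where eq: "\<gamma> = matrix_aut (matrix2 a b c d)"
      by (rule unitary_groupE)
    have *: "map_c (matrix2 a b c d *v z) = map_c z" if "z \<in> unit_ball" for z
      using \<gamma> that by (simp add: invariant_group_def eq matrix_aut_def)
    have 1: "a\<^sup>2 = 1" "c = 0" and 2: "b = 0" "d\<^sup>2 = 1"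
      using *[OF test_vectors_in_ball(1)] *[OF test_vectors_in_ball(2)]
      by (simp_all add: vec3_eq_iff power_mult_distrib power_divide)
    with *[OF test_vectors_in_ball(3)] have "a * d = 1" by (simp add: vec3_eq_iff)
    with 1(1) have "a * (d - a) = 0" by (simp add: power2_eq_square algebra_simps)
    with 1(1) have "d = a" by auto
    then show "\<gamma> \<in> {matrix_aut (matrix2 e 0 0 e) | e. e\<^sup>2 = 1}" using 1 2 by (auto simp: eq)
  qed
  show "{matrix_aut (matrix2 e 0 0 e) | e. e\<^sup>2 = 1} \<subseteq> invariant_group map_c"
  proof
    fix \<gamma> assume "\<gamma> \<in> {matrix_aut (matrix2 e 0 0 e) | e. e\<^sup>2 = 1}"
    then obtain e :: complex where e: "e\<^sup>2 = 1" and \<gamma>: "\<gamma> = matrix_aut (matrix2 e 0 0 e)" by auto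
    from e have "e = 1 \<or> e = -1" by (simp add: power2_eq_1_iff)
    then show "\<gamma> \<in> invariant_group map_c"
      unfolding \<gamma> by (intro matrix_aut_in_invariant_group) (auto simp: unitary_diagonal_iff vec3_eq_iff)
  qed
qed

lemma (in group) cyclic_group_if_generate:
  assumes "subgroup K G" "x \<in> K" "K = generate G {x}"
  shows "cyclic_group (G\<lparr>carrier := K\<rparr>)"
proof -
  have "generate (G\<lparr>carrier := K\<rparr>) {x} = K"
    using generate_consistent[of "{x}" K] assms by auto
  then have "subgroup_generated (G\<lparr>carrier := K\<rparr>) {x} = G\<lparr>carrier := K\<rparr>"
    using assms(2) by (simp add: subgroup_generated_def)
  then show ?thesis unfolding cyclic_group_def using assms(2) by auto
qed

lemma cyclic_invariant_group_c:
  "cyclic_group (ball_aut\<lparr>carrier := invariant_group map_c\<rparr>)" "card (invariant_group map_c) = 2"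
proof -
  interpret group "ball_aut :: (complex ^ 2 \<Rightarrow> complex ^ 2) monoid" by (rule group_ball_aut)
  let ?m = "matrix_aut (matrix2 (-1) 0 0 (-1))"
  have G: "invariant_group map_c = {\<one>\<^bsub>ball_aut\<^esub>, ?m}"
    unfolding invariant_group_c by (auto simp: power2_eq_1_iff matrix2_one simp flip: matrix_aut_one)
  have sub: "subgroup (invariant_group map_c) ball_aut" by (rule subgroup_invariant_group)
  have "invariant_group map_c = generate ball_aut {?m}"
  proof
    show "invariant_group map_c \<subseteq> generate ball_aut {?m}"
      unfolding G by (auto intro: generate.one generate.incl)
    show "generate ball_aut {?m} \<subseteq> invariant_group map_c"
      by (rule generate_subgroup_incl[OF _ sub]) (simp add: G)
  qed
  then show "cyclic_group (ball_aut\<lparr>carrier := invariant_group map_c\<rparr>)"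
    by (rule cyclic_group_if_generate[OF sub, rotated]) (simp add: G)
  have "\<one>\<^bsub>ball_aut\<^esub> \<noteq> ?m"
    unfolding matrix_aut_one[symmetric] matrix2_one
    by (auto dest!: matrix_aut_inject simp: matrix2_eq_iff)
  then show "card (invariant_group map_c) = 2" by (simp add: G)
qed

section \<open>The cubic map\<close>

lemma map_d_diagonal:
  assumes "e ^ 3 = 1"
  shows "map_d (matrix2 e 0 0 (e\<^sup>2) *v z) = map_d z"
proof -
  have "(e\<^sup>2) ^ 3 = (e ^ 3)\<^sup>2" "e * e\<^sup>2 = e ^ 3" by (simp_all add: power2_eq_square power3_eq_cube mult_ac)
  then have "(e\<^sup>2) ^ 3 = 1" "e * e\<^sup>2 = 1" using assms by simp_all
  then show ?thesis using assms
    by (simp add: vec3_eq_iff power_mult_distrib)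
qed

lemma cmod_cube_root: "e ^ 3 = 1 \<Longrightarrow> cmod e = 1"
  by (metis norm_power norm_one norm_ge_zero power_eq_1_iff zero_neq_numeral)

lemma primitive_cube_rootD:
  assumes "primitive_root_of_unity 3 \<eta>"
  shows "\<eta> ^ 3 = 1" "\<eta> \<noteq> 1" "\<eta>\<^sup>2 + \<eta> + 1 = 0"
proof -
  show 3: "\<eta> ^ 3 = 1" using assms by (simp add: primitive_root_of_unity_def)
  have "\<eta> ^ 1 \<noteq> 1" using assms unfolding primitive_root_of_unity_def by (metis less_numeral_extra(1) one_less_numeral_iff semiring_norm(77))
  then show 1: "\<eta> \<noteq> 1" by simp
  have "(\<eta> - 1) * (\<eta>\<^sup>2 + \<eta> + 1) = \<eta> ^ 3 - 1" by (simp add: power2_eq_square power3_eq_cube algebra_simps)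
  then show "\<eta>\<^sup>2 + \<eta> + 1 = 0" using 1 3 by simp
qed

lemma cube_roots:
  assumes "primitive_root_of_unity 3 \<eta>"
  shows "e ^ 3 = 1 \<longleftrightarrow> e = 1 \<or> e = \<eta> \<or> e = \<eta>\<^sup>2"
proof -
  note \<eta> = primitive_cube_rootD[OF assms]
  have "e ^ 3 - 1 = (e - 1) * (e - \<eta>) * (e - \<eta>\<^sup>2)"
    using \<eta>(1,3) by algebra
  then show ?thesis by (metis eq_iff_diff_eq_0 mult_eq_0_iff)
qed

lemma primitive_cube_root_exists: "\<exists>\<eta>. primitive_root_of_unity 3 \<eta>"
proof
  let ?\<eta> = "Complex (- 1/2) (sqrt 3 / 2)"
  have 2: "?\<eta>\<^sup>2 = Complex (- 1/2) (- sqrt 3 / 2)"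
    by (simp add: power2_eq_square complex_eq_iff)
  have 3: "?\<eta> ^ 3 = 1"
    unfolding power3_eq_cube power2_eq_square[symmetric] 2
    by (simp add: 2[unfolded power2_eq_square] complex_eq_iff)
  have "?\<eta> ^ k \<noteq> 1" if "0 < k" "k < 3" for k
  proof -
    have "k = 1 \<or> k = 2" using that by auto
    then show ?thesis using 2 by (auto simp: complex_eq_iff)
  qed
  with 3 show "primitive_root_of_unity 3 ?\<eta>" unfolding primitive_root_of_unity_def by blast
qed

text \<open>Conjugation by a unitary \<open>\<gamma>\<close> in the Hermitian invariant group permutes the diagonal
  matrices \<open>(\<eta>, \<eta>\<^sup>2)\<close> that leave the cubic map invariant, so \<open>\<gamma>\<close> permutes their eigenlines, the
  coordinate axes. Comparing the cubes of the first
  coordinate of \<open>\<gamma>\<close> at two points of the same fibre is enough to see this.\<close>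

lemma hermitian_invariant_group_d_matrix:
  assumes \<gamma>: "matrix_aut (matrix2 a b c d) \<in> hermitian_invariant_group map_d"
    and A: "unitary_matrix (matrix2 a b c d)"
  shows "a * b = 0"
proof -
  obtain \<eta> where "primitive_root_of_unity 3 \<eta>" using primitive_cube_root_exists ..
  note \<eta> = primitive_cube_rootD[OF this]
  have u: "unitary_matrix (matrix2 \<eta> 0 0 (\<eta>\<^sup>2))"
    by (simp add: unitary_diagonal_iff norm_power cmod_cube_root[OF \<eta>(1)])
  have *: "(a * (\<eta> * z $ 1) + b * (\<eta>\<^sup>2 * z $ 2)) ^ 3 = (a * z $ 1 + b * z $ 2) ^ 3"
    if z: "z \<in> unit_ball" for z :: "complex ^ 2"
  proof -
    let ?w = "matrix2 \<eta> 0 0 (\<eta>\<^sup>2) *v z"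
    have w: "?w \<in> unit_ball" using z unitary_matrix_norm[OF u, of z] by simp
    have "map_d (matrix_aut (matrix2 a b c d) ?w) = map_d (matrix_aut (matrix2 a b c d) z)"
      using hermitian_invariant_fibres[OF \<gamma> maps_into_ball(4) w z] map_d_diagonal[OF \<eta>(1)] by blast
    then show ?thesis using w z by (simp add: matrix_aut_def vec3_eq_iff del: mem_ball)
  qed
  have 1: "(a * \<eta> + b * \<eta>\<^sup>2) ^ 3 = (a + b) ^ 3"
    using *[OF test_vectors_in_ball(3)] by (simp add: power_divide flip: add_divide_distrib)
  have 2: "(a * \<eta> - b * \<eta>\<^sup>2) ^ 3 = (a - b) ^ 3"
    using *[OF test_vectors_in_ball(4)] by (simp add: power_divide flip: diff_divide_distrib)
  have "(a * b) * (a + b * (\<eta> + 1)) * (\<eta> - 1) = 0" "(a * b) * (a - b * (\<eta> + 1)) * (\<eta> - 1) = 0"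
    using 1 2 \<eta>(1) by algebra+
  then have "a * b = 0 \<or> a + b * (\<eta> + 1) = 0 \<and> a - b * (\<eta> + 1) = 0" using \<eta>(2) by auto
  moreover have "a = 0" if "a + x = 0" "a - x = 0" for x using that by algebra
  ultimately show ?thesis by fastforce
qed

lemma hermitian_invariant_group_d:
  "hermitian_invariant_group map_d =
    {matrix_aut (matrix2 a 0 0 d) | a d. cmod a = 1 \<and> cmod d = 1} \<union>
    {matrix_aut (matrix2 0 b c 0) | b c. cmod b = 1 \<and> cmod c = 1}" (is "?H = ?D \<union> ?A")
proof
  show "?H \<subseteq> ?D \<union> ?A"
  proof
    fix \<gamma> assume \<gamma>: "\<gamma> \<in> ?H"
    obtain \<eta> where "primitive_root_of_unity 3 \<eta>" using primitive_cube_root_exists ..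
    note \<eta> = primitive_cube_rootD[OF this]
    have \<eta>2: "\<eta>\<^sup>2 \<noteq> 1" using \<eta>(1,2) by (auto simp: power3_eq_cube power2_eq_square)
    have u: "unitary_matrix (matrix2 \<eta> 0 0 (\<eta>\<^sup>2))"
      by (simp add: unitary_diagonal_iff norm_power cmod_cube_root[OF \<eta>(1)])
    have "?H \<subseteq> unitary_group"
      by (rule hermitian_invariant_group_subset_unitary[OF maps_into_ball(4),
            where \<sigma> = "\<lambda>z. matrix2 \<eta> 0 0 (\<eta>\<^sup>2) *v z"])
        (use unitary_matrix_norm[OF u] \<eta>(2) \<eta>2 in
          \<open>auto simp: map_d_diagonal[OF \<eta>(1)] vec2_eq_iff dest!: map_zero_fibres(3)\<close>)
    with \<gamma> have "\<gamma> \<in> unitary_group" by blast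
    then obtain a b c d where A: "unitary_matrix (matrix2 a b c d)" and eq: "\<gamma> = matrix_aut (matrix2 a b c d)"
      by (rule unitary_groupE)
    have "a * b = 0" using \<gamma> A unfolding eq by (rule hermitian_invariant_group_d_matrix)
    with A have "b = 0 \<and> c = 0 \<or> a = 0 \<and> d = 0" by (rule unitary_matrix2_cases)
    then show "\<gamma> \<in> ?D \<union> ?A"
    proof
      assume z: "b = 0 \<and> c = 0"
      then have "cmod a = 1 \<and> cmod d = 1" using A by (simp add: unitary_diagonal_iff)
      then show ?thesis unfolding eq using z by blast
    next
      assume z: "a = 0 \<and> d = 0"
      then have "cmod b = 1 \<and> cmod c = 1" using A by (simp add: unitary_antidiagonal_iff)
      then show ?thesis unfolding eq using z by blast
    qed
  qed
  show "?D \<union> ?A \<subseteq> ?H"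
  proof
    fix \<gamma> assume "\<gamma> \<in> ?D \<union> ?A"
    then consider a d where "cmod a = 1" "cmod d = 1" "\<gamma> = matrix_aut (matrix2 a 0 0 d)"
      | b c where "cmod b = 1" "cmod c = 1" "\<gamma> = matrix_aut (matrix2 0 b c 0)" by auto
    then show "\<gamma> \<in> ?H"
    proof cases
      case 1
      then have u: "unitary_matrix (matrix2 a 0 0 d)" by (simp add: unitary_diagonal_iff)
      have "unitary_matrix (vector [vector [a ^ 3, 0, 0], vector [0, a * d, 0], vector [0, 0, d ^ 3]] :: complex ^ 3 ^ 3)"
        by (rule unitary_diagonal3) (simp_all add: 1 norm_mult norm_power)
      then show ?thesis
        unfolding 1(3) by (rule matrix_aut_in_hermitian_invariant_group[OF u _ maps_into_ball(4)])
          (simp add: vec3_eq_iff matrix_vector_mult_def sum_3 sum_2 power_mult_distrib)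
    next
      case 2
      then have u: "unitary_matrix (matrix2 0 b c 0)" by (simp add: unitary_antidiagonal_iff)
      have "cnj (b ^ 3) * b ^ 3 = 1" "cnj (c ^ 3) * c ^ 3 = 1" "cnj (b * c) * (b * c) = 1"
        unfolding cnj_mult_eq_1_iff by (simp_all add: 2 norm_mult norm_power)
      then have "unitary_matrix (vector [vector [0, 0, b ^ 3], vector [0, b * c, 0], vector [c ^ 3, 0, 0]] :: complex ^ 3 ^ 3)"
        by (intro unitary_matrixI)
          (simp add: vec_eq_iff forall_3 matrix_matrix_mult_def sum_3 conj_transpose_def mat_def)
      then show ?thesis
        unfolding 2(3) by (rule matrix_aut_in_hermitian_invariant_group[OF u _ maps_into_ball(4)])
          (simp add: vec3_eq_iff matrix_vector_mult_def sum_3 sum_2 power_mult_distrib)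
    qed
  qed
qed

lemma invariant_group_d:
  "invariant_group map_d = {matrix_aut (matrix2 e 0 0 (e\<^sup>2)) | e. e ^ 3 = 1}"
proof
  show "invariant_group map_d \<subseteq> {matrix_aut (matrix2 e 0 0 (e\<^sup>2)) | e. e ^ 3 = 1}"
  proof
    fix \<gamma> assume \<gamma>: "\<gamma> \<in> invariant_group map_d"
    then have "\<gamma> \<in> hermitian_invariant_group map_d"
      using invariant_group_subset_hermitian[OF maps_into_ball(4)] by blast
    then obtain a b c d where eq: "\<gamma> = matrix_aut (matrix2 a b c d)"
      unfolding hermitian_invariant_group_d by blast
    have *: "map_d (matrix2 a b c d *v z) = map_d z" if "z \<in> unit_ball" for z
      using \<gamma> that by (simp add: invariant_group_def eq matrix_aut_def)
    have 1: "a ^ 3 = 1" "c = 0" and 2: "b = 0"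
      using *[OF test_vectors_in_ball(1)] *[OF test_vectors_in_ball(2)]
      by (simp_all add: vec3_eq_iff power_mult_distrib power_divide)
    with *[OF test_vectors_in_ball(3)] have "a * d = 1" by (simp add: vec3_eq_iff)
    with 1(1) have "d = a\<^sup>2" by algebra
    then show "\<gamma> \<in> {matrix_aut (matrix2 e 0 0 (e\<^sup>2)) | e. e ^ 3 = 1}" using 1 2 by (auto simp: eq)
  qed
  show "{matrix_aut (matrix2 e 0 0 (e\<^sup>2)) | e. e ^ 3 = 1} \<subseteq> invariant_group map_d"
    by (auto intro!: matrix_aut_in_invariant_group map_d_diagonal
        simp: unitary_diagonal_iff norm_power cmod_cube_root)
qed

lemma invariant_group_d_generated:
  assumes "primitive_root_of_unity 3 \<eta>"
  defines "\<sigma> \<equiv> matrix_aut (matrix2 \<eta> 0 0 (\<eta>\<^sup>2))"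
  shows "\<sigma> \<in> invariant_group map_d" "invariant_group map_d = generate ball_aut {\<sigma>}"
    "card (invariant_group map_d) = 3"
proof -
  interpret group "ball_aut :: (complex ^ 2 \<Rightarrow> complex ^ 2) monoid" by (rule group_ball_aut)
  note \<eta> = primitive_cube_rootD[OF assms(1)]
  have u: "unitary_matrix (matrix2 \<eta> 0 0 (\<eta>\<^sup>2))"
    by (simp add: unitary_diagonal_iff norm_power cmod_cube_root[OF \<eta>(1)])
  have G: "invariant_group map_d =
      {matrix_aut (matrix2 1 0 0 (1\<^sup>2)), \<sigma>, matrix_aut (matrix2 (\<eta>\<^sup>2) 0 0 ((\<eta>\<^sup>2)\<^sup>2))}"
    unfolding invariant_group_d cube_roots[OF assms(1)] \<sigma>_def by blast
  have s2: "matrix_aut (matrix2 (\<eta>\<^sup>2) 0 0 ((\<eta>\<^sup>2)\<^sup>2)) = \<sigma> \<otimes>\<^bsub>ball_aut\<^esub> \<sigma>"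
    unfolding \<sigma>_def matrix_aut_mult[OF u u] by (simp add: matrix2_mult power2_eq_square)
  have s0: "matrix_aut (matrix2 1 0 0 (1\<^sup>2)) = \<one>\<^bsub>ball_aut\<^esub>"
    by (simp add: matrix_aut_one flip: matrix2_one)
  show \<sigma>: "\<sigma> \<in> invariant_group map_d" by (simp add: G)
  show "invariant_group map_d = generate ball_aut {\<sigma>}"
  proof
    show "invariant_group map_d \<subseteq> generate ball_aut {\<sigma>}"
      unfolding G s0 s2 by (auto intro: generate.intros)
    show "generate ball_aut {\<sigma>} \<subseteq> invariant_group map_d"
      by (rule generate_subgroup_incl[OF _ subgroup_invariant_group]) (simp add: \<sigma>)
  qed
  have "\<eta>\<^sup>2 \<noteq> 1" "\<eta>\<^sup>2 \<noteq> \<eta>"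
    using \<eta>(1,2) by (auto simp: power3_eq_cube power2_eq_square)
  then show "card (invariant_group map_d) = 3"
    unfolding G \<sigma>_def using \<eta>(2)
    by (auto simp: matrix2_eq_iff card_insert_if dest!: matrix_aut_inject)
qed

lemma hermitian_invariant_group_d_generated:
  defines "S \<equiv> insert (matrix_aut (matrix2 0 1 1 0))
    {matrix_aut (matrix2 (exp (\<i> * of_real \<theta>)) 0 0 (exp (\<i> * of_real \<phi>))) |\<theta> \<phi> :: real. True}"
  shows "S \<subseteq> unitary_group"
    "hermitian_invariant_group map_d = generate (ball_aut\<lparr>carrier := unitary_group\<rparr>) S"
proof -
  interpret group "ball_aut :: (complex ^ 2 \<Rightarrow> complex ^ 2) monoid" by (rule group_ball_aut)
  show S: "S \<subseteq> unitary_group"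
    unfolding S_def unitary_group_def
    by (auto intro!: imageI simp: unitary_diagonal_iff unitary_antidiagonal_iff)
  have diag: "matrix_aut (matrix2 a 0 0 d) \<in> generate ball_aut S" if "cmod a = 1" "cmod d = 1" for a d
  proof (rule generate.incl)
    have "a = exp (\<i> * of_real (Arg a))" "d = exp (\<i> * of_real (Arg d))"
      using that Arg_eq by (metis norm_zero mult_1 of_real_1 zero_neq_one)+
    then have eq: "matrix_aut (matrix2 a 0 0 d) =
        matrix_aut (matrix2 (exp (\<i> * of_real (Arg a))) 0 0 (exp (\<i> * of_real (Arg d))))"
      by metis
    show "matrix_aut (matrix2 a 0 0 d) \<in> S" unfolding S_def eq by blast
  qed
  have "matrix_aut (matrix2 0 b c 0) \<in> generate ball_aut S" if bc: "cmod b = 1" "cmod c = 1" for b c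
  proof -
    have "matrix_aut (matrix2 0 b c 0) = matrix_aut (matrix2 b 0 0 c) \<otimes>\<^bsub>ball_aut\<^esub> matrix_aut (matrix2 0 1 1 0)"
      by (subst matrix_aut_mult)
        (simp_all add: unitary_diagonal_iff unitary_antidiagonal_iff bc matrix2_mult)
    moreover have "matrix_aut (matrix2 0 1 1 0) \<in> generate ball_aut S"
      by (rule generate.incl) (simp add: S_def)
    ultimately show ?thesis using diag[OF bc] by (simp add: generate.eng)
  qed
  with diag have "hermitian_invariant_group map_d \<subseteq> generate ball_aut S"
    unfolding hermitian_invariant_group_d by auto
  moreover have "generate ball_aut S \<subseteq> hermitian_invariant_group map_d"
  proof (rule generate_subgroup_incl[OF _ subgroup_hermitian_invariant_group[OF maps_into_ball(4)]])
    show "S \<subseteq> hermitian_invariant_group map_d"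
      unfolding S_def hermitian_invariant_group_d by force
  qed
  ultimately show "hermitian_invariant_group map_d = generate (ball_aut\<lparr>carrier := unitary_group\<rparr>) S"
    using generate_consistent[OF S subgroup_unitary_group] by simp
qed

section \<open>The groups of the four maps\<close>

theorem proposition7p1:
  shows "(proper_holomorphic_ball_map map_a \<and> proper_holomorphic_ball_map map_b \<and>
      proper_holomorphic_ball_map map_c \<and> proper_holomorphic_ball_map map_d) \<and>
    (invariant_group map_a = {\<one>\<^bsub>ball_aut\<^esub>} \<and>
      hermitian_invariant_group map_a = carrier ball_aut) \<and>
    (invariant_group map_b = {\<one>\<^bsub>ball_aut\<^esub>} \<and>
      hermitian_invariant_group map_b = diagonal_unitary_group) \<and>
    (subgroup (invariant_group map_c) ball_aut \<and>
      cyclic_group (ball_aut\<lparr>carrier := invariant_group map_c\<rparr>) \<and>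
      card (invariant_group map_c) = 2 \<and>
      hermitian_invariant_group map_c = unitary_group) \<and>
    (subgroup (invariant_group map_d) ball_aut \<and>
      cyclic_group (ball_aut\<lparr>carrier := invariant_group map_d\<rparr>) \<and>
      card (invariant_group map_d) = 3 \<and>
      (\<forall>\<eta>. primitive_root_of_unity 3 \<eta> \<longrightarrow>
        matrix_aut (matrix2 \<eta> 0 0 (\<eta>\<^sup>2)) \<in> carrier ball_aut \<and>
        invariant_group map_d = generate ball_aut {matrix_aut (matrix2 \<eta> 0 0 (\<eta>\<^sup>2))})) \<and>
    (insert (matrix_aut (matrix2 0 1 1 0))
        {matrix_aut (matrix2 (exp (\<i> * of_real \<theta>)) 0 0 (exp (\<i> * of_real \<phi>))) |\<theta> \<phi> :: real. True}
        \<subseteq> unitary_group \<and>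
      hermitian_invariant_group map_d = generate (ball_aut\<lparr>carrier := unitary_group\<rparr>)
        (insert (matrix_aut (matrix2 0 1 1 0))
          {matrix_aut (matrix2 (exp (\<i> * of_real \<theta>)) 0 0 (exp (\<i> * of_real \<phi>))) |\<theta> \<phi> :: real. True}))"
proof -
  interpret group "ball_aut :: (complex ^ 2 \<Rightarrow> complex ^ 2) monoid" by (rule group_ball_aut)
  obtain \<eta> where \<eta>: "primitive_root_of_unity 3 \<eta>" using primitive_cube_root_exists ..
  have cyclic: "cyclic_group (ball_aut\<lparr>carrier := invariant_group map_d\<rparr>)"
    by (rule cyclic_group_if_generate[OF subgroup_invariant_group invariant_group_d_generated(1,2)[OF \<eta>]])
  have mem: "matrix_aut (matrix2 \<epsilon> 0 0 (\<epsilon>\<^sup>2)) \<in> carrier ball_aut" if "primitive_root_of_unity 3 \<epsilon>" for \<epsilon>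
    by (rule subgroup.mem_carrier[OF subgroup_invariant_group invariant_group_d_generated(1)[OF that]])
  show ?thesis
    using proper_maps invariant_group_a hermitian_invariant_group_a invariant_group_b
      hermitian_invariant_group_b cyclic_invariant_group_c hermitian_invariant_group_c cyclic mem
      subgroup_invariant_group invariant_group_d_generated(2) invariant_group_d_generated(3)[OF \<eta>]
      hermitian_invariant_group_d_generated
    by (intro conjI allI impI)
qed

end
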